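(* Let $\mathbb{F}$ be an algebraically closed field, $\mathrm{char}\,\mathbb{F}\ne2,3$, let $\mathbb{L}=\mathbb{F}\times\mathbb{F}\times\mathbb{F}$ with $\rho(\lambda_1,\lambda_2,\lambda_3)=(\lambda_2,\lambda_3,\lambda_1)$. Let $\Gamma$ be a Type III grading by an abelian group $G$ on the cyclic composition algebra $(V,\mathbb{L},\rho,*,Q)$ of rank $8$ over $\mathbb{F}$, and let $\Gamma_{\mathbb{L}}$ be the induced grading on $\mathbb{L}$. (1) If $V_e=0$, then $(V,\mathbb{L},\rho,*,Q)$ is isomorphic to $(\mathcal{O},\star,n)\otimes(\mathbb{L},\rho)$ as a graded cyclic composition algebra, where $(\mathcal{O},\star,n)$ is the Okubo algebra, endowed with a $G$-grading $\Gamma_{\mathcal{O}}$ with $\mathcal{O}_e=0$, and the grading on $(\mathcal{O},\star,n)\otimes(\mathbb{L},\rho)$ is $\Gamma_{\mathcal{O}}\otimes\Gamma_{\mathbb{L}}$. (2) Otherwise, $(V,\mathbb{L},\rho,*,Q)$ is isomorphic to $(\mathcal{C},\bullet,n)\otimes(\mathbb{L},\rho)$ as a graded cyclic composition algebra, where $(\mathcal{C},\bullet,n)$ is the para-Cayley algebra, endowed with a $G$-grading $\Gamma_{\mathcal{C}}$, and the grading on $(\mathcal{C},\bullet,n)\otimes(\mathbb{L},\rho)$ is $\Gamma_{\mathcal{C}}\otimes\Gamma_{\mathbb{L}}$.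
   Context: A cyclic composition algebra over $(\mathbb{L},\rho)$ is a free $\mathbb{L}$-module $V$ with a nonsingular $\mathbb{L}$-valued quadratic form $Q$, with polar form $b_Q(x,y)=Q(x+y)-Q(x)-Q(y)$, and an $\mathbb{F}$-bilinear multiplication $*$ on $V$, $\rho$-semilinear in the first and $\rho^2$-semilinear in the second argument, such that $Q(x*y)=\rho(Q(x))\rho^2(Q(y))$ and $b_Q(x*y,z)=\rho(b_Q(y*z,x))=\rho^2(b_Q(z*x,y))$; its rank is the $\mathbb{L}$-rank of $V$. An isomorphism is a pair $(\varphi_1,\varphi_0)$ with $\varphi_0$ an $\mathbb{F}$-algebra isomorphism of the $\mathbb{L}$'s commuting with the $\rho$'s and $\varphi_1$ a $\varphi_0$-semilinear bijection preserving $*$ and satisfying $\varphi_0(Q(x))=Q'(\varphi_1(x))$. A $G$-grading on it consists of a $G$-grading on the $\mathbb{F}$-algebra $(V,* )$ and a $G$-grading on the algebra $\mathbb{L}$ (with $\rho$ degree-preserving) such that $V$ is a graded $\mathbb{L}$-module and $b_Q$ is degree-preserving ($b_Q(V_a,V_b)\subset\mathbb{L}_{ab}$). It is of Type III if $\mathbb{L}$ has three one-dimensional components $\mathbb{L}_e=\mathbb{F}1$, $\mathbb{L}_h=\mathbb{F}\xi$, $\mathbb{L}_{h^2}=\mathbb{F}\xi^2$, where $\xi=(1,\omega,\omega^2)$, $\omega$ a primitive cube root of unity, and $h\in G$ has order $3$. Isomorphisms of graded cyclic composition algebras preserve degrees. $e$ is the identity of $G$. A symmetric composition algebra $(\mathcal{S},\star,n)$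 is a finite-dimensional algebra with a nonsingular quadratic form $n$ such that $n(x\star y)=n(x)n(y)$ and the polar form satisfies $n(x\star y,z)=n(x,y\star z)$. Over an algebraically closed field there are, up to isomorphism, exactly two of dimension $8$: the para-Cayley algebra, i.e. the Cayley (octonion) algebra $\mathcal{C}$ with product $x\bullet y=\bar x\bar y$ and its norm $n$ (bar the standard involution), and the other one, called the Okubo algebra $(\mathcal{O},\star,n)$. For a symmetric composition algebra, $(\mathcal{S},\star,n)\otimes(\mathbb{L},\rho)$ is the cyclic composition algebra $V=\mathcal{S}\otimes\mathbb{L}$ with $(x\otimes\ell)*(y\otimes m)=(x\star y)\otimes\rho(\ell)\rho^2(m)$, $Q(x\otimes\ell)=n(x)\ell^2$, $b_Q(x\otimes\ell,y\otimes m)=n(x,y)\ell m$. Given $G$-gradings $\Gamma_{\mathcal{S}}$ on $\mathcal{S}$ and $\Gamma_{\mathbb{L}}$ on $\mathbb{L}$, $\Gamma_{\mathcal{S}}\otimes\Gamma_{\mathbb{L}}$ is the $G$-grading with $(\mathcal{S}\otimes\mathbb{L})_g=\bigoplus_{k\in G}\mathcal{S}_{gk^{-1}}\otimes\mathbb{L}_k$ (and $\Gamma_{\mathbb{L}}$ on $\mathbb{L}$). *)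

theory Defs
  imports "HOL-Analysis.Analysis" "HOL-Computational_Algebra.Polynomial"
begin

section \<open>Quadratic forms and bilinear maps over a commutative ring\<close>

definition polar :: "('v::ab_group_add \<Rightarrow> 'r::comm_ring_1) \<Rightarrow> 'v \<Rightarrow> 'v \<Rightarrow> 'r" where
  "polar Q x y = Q (x + y) - Q x - Q y"

definition bilinear_over ::
  "('r::comm_ring_1 \<Rightarrow> 'a::ab_group_add \<Rightarrow> 'a) \<Rightarrow> ('r \<Rightarrow> 'b::ab_group_add \<Rightarrow> 'b) \<Rightarrow>
   ('r \<Rightarrow> 'c::ab_group_add \<Rightarrow> 'c) \<Rightarrow> ('a \<Rightarrow> 'b \<Rightarrow> 'c) \<Rightarrow> bool" where
  "bilinear_over sa sb sc f \<longleftrightarrow>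
     (\<forall>x. module_hom sb sc (f x)) \<and> (\<forall>y. module_hom sa sc (\<lambda>x. f x y))"

definition quadratic_form ::
  "('r::comm_ring_1 \<Rightarrow> 'v::ab_group_add \<Rightarrow> 'v) \<Rightarrow> ('v \<Rightarrow> 'r) \<Rightarrow> bool" where
  "quadratic_form smul Q \<longleftrightarrow>
     (\<forall>a x. Q (smul a x) = a ^ 2 * Q x) \<and> bilinear_over smul smul (*) (polar Q)"

definition nonsingular :: "('v::ab_group_add \<Rightarrow> 'r::comm_ring_1) \<Rightarrow> bool" where
  "nonsingular Q \<longleftrightarrow> (\<forall>x. (\<forall>y. polar Q x y = 0) \<longrightarrow> x = 0)"

definition free_module :: "('r::comm_ring_1 \<Rightarrow> 'v::ab_group_add \<Rightarrow> 'v) \<Rightarrow> bool" where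
  "free_module smul \<longleftrightarrow>
     (\<exists>B. \<not> module.dependent smul B \<and> module.span smul B = UNIV)"

definition has_rank :: "('r::comm_ring_1 \<Rightarrow> 'v::ab_group_add \<Rightarrow> 'v) \<Rightarrow> nat \<Rightarrow> bool" where
  "has_rank smul r \<longleftrightarrow>
     (\<exists>B. finite B \<and> card B = r \<and> \<not> module.dependent smul B \<and> module.span smul B = UNIV)"


section \<open>Group gradings\<close>

text \<open>The abelian grading group is written additively, so its identity is \<open>0\<close>.\<close>

definition vector_grading ::
  "('f::field \<Rightarrow> 'a::ab_group_add \<Rightarrow> 'a) \<Rightarrow> ('g \<Rightarrow> 'a set) \<Rightarrow> bool" where
  "vector_grading smul A \<longleftrightarrow>
     (\<forall>g. module.subspace smul (A g)) \<and>
     (\<forall>x. \<exists>!c. (\<forall>g. c g \<in> A g) \<and> finite {g. c g \<noteq> 0} \<and> x = (\<Sum>g | c g \<noteq> 0. c g))"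

definition algebra_grading ::
  "('f::field \<Rightarrow> 'a::ab_group_add \<Rightarrow> 'a) \<Rightarrow> ('a \<Rightarrow> 'a \<Rightarrow> 'a) \<Rightarrow>
   ('g::ab_group_add \<Rightarrow> 'a set) \<Rightarrow> bool" where
  "algebra_grading smul m A \<longleftrightarrow>
     vector_grading smul A \<and> (\<forall>g k. \<forall>x\<in>A g. \<forall>y\<in>A k. m x y \<in> A (g + k))"


section \<open>The cubic algebra \<open>F \<times> F \<times> F\<close>\<close>

text \<open>
  The algebra is the type \<^typ>\<open>'f ^ 3\<close> with its componentwise product; its scalar
  multiplication over the field is \<^const>\<open>vector_scalar_mult\<close>, and the field embeds by
  \<^const>\<open>vec\<close>. Indices live in the cyclic type \<open>3\<close>, where \<open>3 = 0\<close>.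
\<close>

definition rho :: "'f ^ 3 \<Rightarrow> 'f ^ 3" where
  "rho l = (\<chi> i. l $ (i + 1))"

lemma rho_vector: "rho (vector [a, b, c] :: 'f::zero ^ 3) = vector [b, c, a]"
proof -
  have "(4 :: 3) = 1" by simp
  then have "v $ (4 :: 3) = v $ 1" for v :: "'f ^ 3" by (rule arg_cong)
  then show ?thesis by (simp add: rho_def vec_eq_iff forall_3 vector_3)
qed

definition restrict_scalars ::
  "('f ^ 3 \<Rightarrow> 'v \<Rightarrow> 'v) \<Rightarrow> 'f \<Rightarrow> 'v \<Rightarrow> 'v" where
  "restrict_scalars smul a = smul (vec a)"

lemma restrict_scalars_times:
  "restrict_scalars (*) = (vector_scalar_mult :: 'f::comm_ring_1 \<Rightarrow> 'f ^ 3 \<Rightarrow> 'f ^ 3)"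
  by (auto simp: fun_eq_iff restrict_scalars_def vec_eq_iff)


section \<open>Cyclic composition algebras\<close>

locale cyclic_composition_algebra =
  module smul for smul :: "('f::field) ^ 3 \<Rightarrow> 'v::ab_group_add \<Rightarrow> 'v" +
  fixes m :: "'v \<Rightarrow> 'v \<Rightarrow> 'v" and Q :: "'v \<Rightarrow> 'f ^ 3"
  assumes free: "free_module smul"
    and quadratic: "quadratic_form smul Q"
    and nonsing: "nonsingular Q"
    and bilinear_m: "bilinear_over (restrict_scalars smul) (restrict_scalars smul)
                       (restrict_scalars smul) m"
    and semilinear_left: "m (smul l x) y = smul (rho l) (m x y)"
    and semilinear_right: "m x (smul l y) = smul (rho (rho l)) (m x y)"
    and Q_m: "Q (m x y) = rho (Q x) * rho (rho (Q y))"
    and polar_cyclic1: "polar Q (m x y) z = rho (polar Q (m y z) x)"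
    and polar_cyclic2: "polar Q (m x y) z = rho (rho (polar Q (m z x) y))"

definition cyclic_composition_grading ::
  "(('f::field) ^ 3 \<Rightarrow> 'v::ab_group_add \<Rightarrow> 'v) \<Rightarrow> ('v \<Rightarrow> 'v \<Rightarrow> 'v) \<Rightarrow> ('v \<Rightarrow> 'f ^ 3) \<Rightarrow>
   ('g::ab_group_add \<Rightarrow> 'v set) \<Rightarrow> ('g \<Rightarrow> ('f ^ 3) set) \<Rightarrow> bool" where
  "cyclic_composition_grading smul m Q V L \<longleftrightarrow>
     algebra_grading (restrict_scalars smul) m V \<and>
     algebra_grading vector_scalar_mult (*) L \<and>
     (\<forall>g. \<forall>l\<in>L g. rho l \<in> L g) \<and>
     (\<forall>g k. \<forall>l\<in>L g. \<forall>x\<in>V k. smul l x \<in> V (g + k)) \<and>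
     (\<forall>g k. \<forall>x\<in>V g. \<forall>y\<in>V k. polar Q x y \<in> L (g + k))"

text \<open>
  All components of \<open>L\<close> outside \<open>{0, h, 2h}\<close> vanish, since the three displayed lines already
  span \<open>'f ^ 3\<close>.
\<close>

definition type_III :: "('g::ab_group_add \<Rightarrow> (('f::field) ^ 3) set) \<Rightarrow> bool" where
  "type_III L \<longleftrightarrow>
     (\<exists>\<omega> h. \<omega> ^ 3 = 1 \<and> \<omega> \<noteq> 1 \<and> h \<noteq> 0 \<and> h + h + h = 0 \<and>
        (let \<xi> = vector [1, \<omega>, \<omega> ^ 2] in
           L 0 = range (\<lambda>a. a *s 1) \<and>
           L h = range (\<lambda>a. a *s \<xi>) \<and>
           L (h + h) = range (\<lambda>a. a *s \<xi> ^ 2)))"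

definition cyclic_composition_iso ::
  "(('f::field) ^ 3 \<Rightarrow> 'v::ab_group_add \<Rightarrow> 'v) \<Rightarrow> ('v \<Rightarrow> 'v \<Rightarrow> 'v) \<Rightarrow> ('v \<Rightarrow> 'f ^ 3) \<Rightarrow>
   ('f ^ 3 \<Rightarrow> 'w::ab_group_add \<Rightarrow> 'w) \<Rightarrow> ('w \<Rightarrow> 'w \<Rightarrow> 'w) \<Rightarrow> ('w \<Rightarrow> 'f ^ 3) \<Rightarrow>
   ('v \<Rightarrow> 'w) \<Rightarrow> ('f ^ 3 \<Rightarrow> 'f ^ 3) \<Rightarrow> bool" where
  "cyclic_composition_iso smul m Q smul' m' Q' \<phi>1 \<phi>0 \<longleftrightarrow>
     bij \<phi>0 \<and> module_hom vector_scalar_mult vector_scalar_mult \<phi>0 \<and>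
     \<phi>0 1 = 1 \<and> (\<forall>k l. \<phi>0 (k * l) = \<phi>0 k * \<phi>0 l) \<and> (\<forall>l. \<phi>0 (rho l) = rho (\<phi>0 l)) \<and>
     bij \<phi>1 \<and> (\<forall>x y. \<phi>1 (x + y) = \<phi>1 x + \<phi>1 y) \<and>
     (\<forall>l x. \<phi>1 (smul l x) = smul' (\<phi>0 l) (\<phi>1 x)) \<and>
     (\<forall>x y. \<phi>1 (m x y) = m' (\<phi>1 x) (\<phi>1 y)) \<and>
     (\<forall>x. \<phi>0 (Q x) = Q' (\<phi>1 x))"

definition graded_isomorphic ::
  "(('f::field) ^ 3 \<Rightarrow> 'v::ab_group_add \<Rightarrow> 'v) \<Rightarrow> ('v \<Rightarrow> 'v \<Rightarrow> 'v) \<Rightarrow> ('v \<Rightarrow> 'f ^ 3) \<Rightarrow>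
   ('g \<Rightarrow> 'v set) \<Rightarrow> ('g \<Rightarrow> ('f ^ 3) set) \<Rightarrow>
   ('f ^ 3 \<Rightarrow> 'w::ab_group_add \<Rightarrow> 'w) \<Rightarrow> ('w \<Rightarrow> 'w \<Rightarrow> 'w) \<Rightarrow> ('w \<Rightarrow> 'f ^ 3) \<Rightarrow>
   ('g \<Rightarrow> 'w set) \<Rightarrow> ('g \<Rightarrow> ('f ^ 3) set) \<Rightarrow> bool" where
  "graded_isomorphic smul m Q V L smul' m' Q' V' L' \<longleftrightarrow>
     (\<exists>\<phi>1 \<phi>0. cyclic_composition_iso smul m Q smul' m' Q' \<phi>1 \<phi>0 \<and>
        (\<forall>g. \<phi>1 ` V g = V' g) \<and> (\<forall>g. \<phi>0 ` L g = L' g))"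


section \<open>Symmetric composition algebras\<close>

locale symmetric_composition_algebra =
  vector_space smul for smul :: "'f::field \<Rightarrow> 's::ab_group_add \<Rightarrow> 's" +
  fixes star :: "'s \<Rightarrow> 's \<Rightarrow> 's" and n :: "'s \<Rightarrow> 'f"
  assumes finite_dim: "\<exists>B. finite B \<and> module.span smul B = UNIV"
    and bilinear_star: "bilinear_over smul smul smul star"
    and quadratic: "quadratic_form smul n"
    and nonsing: "nonsingular n"
    and n_star: "n (star x y) = n x * n y"
    and polar_assoc: "polar n (star x y) z = polar n x (star y z)"

text \<open>A Cayley algebra is a unital composition algebra of dimension 8.\<close>

locale cayley_algebra =
  vector_space smul for smul :: "'f::field \<Rightarrow> 's::ab_group_add \<Rightarrow> 's" +
  fixes m :: "'s \<Rightarrow> 's \<Rightarrow> 's" and u :: 's and n :: "'s \<Rightarrow> 'f"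
  assumes dim_8: "vector_space.dim smul UNIV = 8"
    and bilinear_m: "bilinear_over smul smul smul m"
    and unit_left: "m u x = x"
    and unit_right: "m x u = x"
    and quadratic: "quadratic_form smul n"
    and nonsing: "nonsingular n"
    and n_m: "n (m x y) = n x * n y"

definition standard_involution ::
  "('f::field \<Rightarrow> 's::ab_group_add \<Rightarrow> 's) \<Rightarrow> 's \<Rightarrow> ('s \<Rightarrow> 'f) \<Rightarrow> 's \<Rightarrow> 's" where
  "standard_involution smul u n x = smul (polar n x u) u - x"

definition para_cayley_algebra ::
  "('f::field \<Rightarrow> 's::ab_group_add \<Rightarrow> 's) \<Rightarrow> ('s \<Rightarrow> 's \<Rightarrow> 's) \<Rightarrow> ('s \<Rightarrow> 'f) \<Rightarrow> bool" where
  "para_cayley_algebra smul star n \<longleftrightarrow>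
     (\<exists>m u. cayley_algebra smul m u n \<and>
        (\<forall>x y. star x y =
           m (standard_involution smul u n x) (standard_involution smul u n y)))"

definition symmetric_composition_iso ::
  "('f::field \<Rightarrow> 's::ab_group_add \<Rightarrow> 's) \<Rightarrow> ('s \<Rightarrow> 's \<Rightarrow> 's) \<Rightarrow> ('s \<Rightarrow> 'f) \<Rightarrow>
   ('f \<Rightarrow> 't::ab_group_add \<Rightarrow> 't) \<Rightarrow> ('t \<Rightarrow> 't \<Rightarrow> 't) \<Rightarrow> ('t \<Rightarrow> 'f) \<Rightarrow> ('s \<Rightarrow> 't) \<Rightarrow> bool" where
  "symmetric_composition_iso smul star n smul' star' n' \<phi> \<longleftrightarrow>
     bij \<phi> \<and> module_hom smul smul' \<phi> \<and>
     (\<forall>x y. \<phi> (star x y) = star' (\<phi> x) (\<phi> y)) \<and> (\<forall>x. n' (\<phi> x) = n x)"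

text \<open>
  Over an algebraically closed field there is only one Cayley algebra up to isomorphism, and the
  8-dimensional symmetric composition algebras form exactly two isomorphism classes; the Okubo
  algebra is the one that is not para-Cayley. Any two 8-dimensional vector spaces are isomorphic,
  so it suffices to compare with the para-Cayley algebras on the same vector space.
\<close>

definition okubo_algebra ::
  "('f::field \<Rightarrow> 's::ab_group_add \<Rightarrow> 's) \<Rightarrow> ('s \<Rightarrow> 's \<Rightarrow> 's) \<Rightarrow> ('s \<Rightarrow> 'f) \<Rightarrow> bool" where
  "okubo_algebra smul star n \<longleftrightarrow>
     symmetric_composition_algebra smul star n \<and> vector_space.dim smul UNIV = 8 \<and>
     \<not> (\<exists>star' n' \<phi>. para_cayley_algebra smul star' n' \<and>
          symmetric_composition_iso smul star n smul star' n' \<phi>)"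


section \<open>The cyclic composition algebra \<open>S \<otimes> F \<times> F \<times> F\<close>\<close>

text \<open>
  The tensor product of a vector space \<open>'s\<close> with \<open>F \<times> F \<times> F\<close> is modelled by \<open>'s ^ 3\<close>, where
  the pure tensor of \<open>x\<close> and \<open>l\<close> is \<open>(l\<^sub>1 x, l\<^sub>2 x, l\<^sub>3 x)\<close>. The lemmas below establish its
  universal property and recover the usual formulas for the operations on pure tensors.
\<close>

definition tensor :: "('f \<Rightarrow> 's \<Rightarrow> 's) \<Rightarrow> 's \<Rightarrow> 'f ^ 3 \<Rightarrow> 's ^ 3" where
  "tensor smul x l = (\<chi> j. smul (l $ j) x)"

definition tensor_scale :: "('f \<Rightarrow> 's \<Rightarrow> 's) \<Rightarrow> 'f ^ 3 \<Rightarrow> 's ^ 3 \<Rightarrow> 's ^ 3" where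
  "tensor_scale smul l v = (\<chi> j. smul (l $ j) (v $ j))"

definition tensor_mult :: "('s \<Rightarrow> 's \<Rightarrow> 's) \<Rightarrow> 's ^ 3 \<Rightarrow> 's ^ 3 \<Rightarrow> 's ^ 3" where
  "tensor_mult star v w = (\<chi> j. star (v $ (j + 1)) (w $ (j + 2)))"

definition tensor_Q :: "('s \<Rightarrow> 'f) \<Rightarrow> 's ^ 3 \<Rightarrow> 'f ^ 3" where
  "tensor_Q n v = (\<chi> j. n (v $ j))"

definition tensor_grading ::
  "('f::field \<Rightarrow> 's::ab_group_add \<Rightarrow> 's) \<Rightarrow> ('g::ab_group_add \<Rightarrow> 's set) \<Rightarrow>
   ('g \<Rightarrow> ('f ^ 3) set) \<Rightarrow> 'g \<Rightarrow> ('s ^ 3) set" where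
  "tensor_grading smul S L g =
     module.span (restrict_scalars (tensor_scale smul))
       {tensor smul x l | x l k. x \<in> S (g - k) \<and> l \<in> L k}"

lemma bilinear_tensor:
  assumes "vector_space smul"
  shows "bilinear_over smul vector_scalar_mult (restrict_scalars (tensor_scale smul)) (tensor smul)"
proof -
  interpret vector_space smul by fact
  show ?thesis
    unfolding bilinear_over_def
    by (auto intro!: module_hom.intro module.intro module_hom_axioms.intro
        simp: tensor_def tensor_scale_def restrict_scalars_def vec_eq_iff algebra_simps)
qed

lemma tensor_universal:
  fixes f :: "'s::ab_group_add \<Rightarrow> ('f::field) ^ 3 \<Rightarrow> 'w::ab_group_add"
  assumes "vector_space smul" and "bilinear_over smul vector_scalar_mult t f"
  shows "\<exists>!g. module_hom (restrict_scalars (tensor_scale smul)) t g \<and>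
              (\<forall>x l. g (tensor smul x l) = f x l)"
proof -
  interpret vector_space smul by fact
  have t: "module t" and f1: "\<And>l. module_hom smul t (\<lambda>x. f x l)"
    and f2: "\<And>x. module_hom vector_scalar_mult t (f x)"
    using assms(2) by (auto simp: bilinear_over_def module_hom_def)
  note f1' = module_hom.add[OF f1] module_hom.scale[OF f1]
  note f2' = module_hom.add[OF f2] module_hom.scale[OF f2]
  define g where "g = (\<lambda>v :: 's ^ 3. \<Sum>j\<in>UNIV. f (v $ j) (axis j 1))"
  have mod: "module (restrict_scalars (tensor_scale smul))"
    using bilinear_tensor[OF assms(1)] by (auto simp: bilinear_over_def module_hom_def)
  have "module_hom (restrict_scalars (tensor_scale smul)) t g"
    using t mod
    by (auto intro!: module_hom.intro module_hom_axioms.intro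
        simp: g_def restrict_scalars_def tensor_scale_def f1' sum.distrib module.scale_sum_right)
  moreover have "g (tensor smul x l) = f x l" for x l
  proof -
    have "g (tensor smul x l) = (\<Sum>j\<in>UNIV. f x (l $ j *s axis j 1))"
      by (simp add: g_def tensor_def f1' f2')
    also have "\<dots> = f x (\<Sum>j\<in>UNIV. l $ j *s axis j 1)"
      by (simp add: module_hom.sum[OF f2])
    also have "(\<Sum>j\<in>UNIV. l $ j *s axis j 1) = l"
      by (simp add: basis_expansion)
    finally show ?thesis .
  qed
  moreover have "h = g" if h: "module_hom (restrict_scalars (tensor_scale smul)) t h"
    and ht: "\<forall>x l. h (tensor smul x l) = f x l" for h
  proof
    fix v
    have "v = (\<Sum>j\<in>UNIV. tensor smul (v $ j) (axis j 1))"
      by (simp add: tensor_def vec_eq_iff axis_def if_distrib[of "\<lambda>a. smul a _"] sum.delta cong: if_cong)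
    then have "h v = (\<Sum>j\<in>UNIV. h (tensor smul (v $ j) (axis j 1)))"
      by (metis (no_types, lifting) module_hom.sum[OF h] sum.cong)
    then show "h v = g v"
      by (simp add: g_def ht)
  qed
  ultimately show ?thesis
    by blast
qed

lemma tensor_scale_tensor:
  assumes "vector_space smul"
  shows "tensor_scale smul k (tensor smul x l) = tensor smul x (k * l)"
  using assms by (simp add: tensor_def tensor_scale_def vec_eq_iff vector_space_def)

lemma tensor_mult_tensor:
  assumes "bilinear_over smul smul smul star"
  shows "tensor_mult star (tensor smul x l) (tensor smul y k) =
         tensor smul (star x y) (rho l * rho (rho k))"
proof -
  interpret module smul
    using assms by (auto simp: bilinear_over_def module_hom_def)
  have l: "star (smul a v) w = smul a (star v w)"
    and r: "star v (smul a w) = smul a (star v w)" for a v w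
    using assms by (auto simp: bilinear_over_def module_hom_def module_hom_axioms_def)
  have "j + 1 + 1 = j + 2" for j :: 3
    by (simp add: add.assoc)
  then show ?thesis
    by (simp add: tensor_def tensor_mult_def rho_def vec_eq_iff l r ac_simps)
qed

lemma tensor_Q_tensor:
  assumes "quadratic_form smul n"
  shows "tensor_Q n (tensor smul x l) = vec (n x) * l ^ 2"
  using assms
  by (simp add: quadratic_form_def tensor_def tensor_Q_def vec_eq_iff power2_eq_square ac_simps)

lemma polar_tensor_Q_tensor:
  assumes "quadratic_form smul n"
  shows "polar (tensor_Q n) (tensor smul x l) (tensor smul y k) = vec (polar n x y) * l * k"
proof -
  have l: "polar n (smul a v) w = a * polar n v w"
    and r: "polar n v (smul a w) = a * polar n v w" for a v w
    using assms
    by (auto simp: quadratic_form_def bilinear_over_def module_hom_def module_hom_axioms_def)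
  have "polar (tensor_Q n) v w = (\<chi> j. polar n (v $ j) (w $ j))" for v w
    by (simp add: polar_def tensor_Q_def vec_eq_iff)
  then show ?thesis
    by (simp add: tensor_def vec_eq_iff l r ac_simps)
qed

end

theory Submission
  imports Defs
begin

text \<open>
  Write \<open>b\<close> for the polar form of \<open>Q\<close> and \<open>\<xi> = (1, \<omega>, \<omega>\<^sup>2)\<close>, and call an \<open>F\<close>-subspace \<open>S\<close> of \<open>V\<close> a
  form of \<open>V\<close> if \<open>S * S \<subseteq> S\<close>, \<open>Q(S) \<subseteq> F\<close> and every \<open>V\<^sub>g\<close> is the sum of its intersection with \<open>S\<close> and
  of \<open>\<xi> (S \<inter> V\<^bsub>g-h\<^esub>)\<close> and \<open>\<xi>\<^sup>2 (S \<inter> V\<^bsub>g-2h\<^esub>)\<close>. Then \<open>S\<close> is a graded symmetric composition algebra with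
  \<open>V = S \<otimes> L\<close>, so it suffices to find a suitable form.

  If \<open>V\<^sub>0 \<noteq> 0\<close>, then \<open>Q\<close> does not vanish on \<open>V\<^sub>0\<close>, and solving a cubic equation gives an idempotent \<open>e\<close>
  in \<open>V\<^sub>0\<close> with \<open>Q(e) = 1\<close>. The map \<open>x \<mapsto> e * (e * x)\<close> is a \<open>\<rho>\<close>-semilinear automorphism of order 3 that
  preserves degrees; its fixed points are a form on which \<open>e\<close> is a para-unit.

  If \<open>V\<^sub>0 = 0\<close> and \<open>0 \<noteq> x \<in> V\<^sub>g\<close>, choose \<open>y \<in> V\<^bsub>-g\<^esub>\<close> with \<open>b(x, y) = 1\<close>. Since \<open>x * y = y * x = 0\<close>, the
  composition identities give \<open>Q(x) = 0\<close> and \<open>(x * x) * y = x\<close>, so \<open>x * x \<noteq> 0\<close>; applying this to \<open>x * x\<close>,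
  also \<open>b(x * x, x) x = (x * x) * (x * x) \<noteq> 0\<close>. As \<open>b(x * x, x)\<close> is fixed by \<open>\<rho>\<close>, it has degree 0,
  whence \<open>3g = 0\<close>. A subgroup maximal among those avoiding \<open>h\<close> complements \<open>{0, h, 2h}\<close> on the
  3-torsion, so the components with degrees in it span a form. A para-unit \<open>u\<close> of it would lie in the span of
  \<open>x\<close> and \<open>x * x\<close> for every nonzero homogeneous \<open>x\<close>, while each component would be spanned by a
  component of \<open>u\<close>, forcing dimension at most 2.
\<close>

section \<open>Cyclic composition algebras\<close>

lemma rho_component [simp]: "rho l $ i = l $ (i + 1)"
  by (simp add: rho_def)

lemma rho_add [simp]: "rho (k + l) = rho k + rho (l :: 'f::field ^ 3)"
  and rho_diff [simp]: "rho (k - l) = rho k - rho (l :: 'f::field ^ 3)"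
  and rho_mult [simp]: "rho (k * l) = rho k * rho (l :: 'f::field ^ 3)"
  and rho_0 [simp]: "rho 0 = (0 :: 'f::field ^ 3)"
  and rho_1 [simp]: "rho 1 = (1 :: 'f::field ^ 3)"
  and rho_vec [simp]: "rho (vec a) = (vec a :: 'f::field ^ 3)"
  by (simp_all add: vec_eq_iff)

lemma rho_rho_rho [simp]: "rho (rho (rho l)) = l"
proof -
  have "i + 1 + 1 + 1 = i" for i :: 3
    using exhaust_3[of i] by auto
  then show ?thesis by (simp only: vec_eq_iff rho_component) simp
qed

lemma rho_eq_iff [simp]: "rho k = rho l \<longleftrightarrow> k = l"
  by (metis rho_rho_rho)

lemma rho_fixed_imp_vec:
  assumes "rho l = l" shows "l = vec (l $ 1)"
proof -
  have "l $ (i + 1) = l $ i" for i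
    using assms by (metis rho_component)
  from this[of 1] this[of 2] show ?thesis
    by (simp add: vec_eq_iff forall_3)
qed

lemma vec_mult: "vec (a * b) = (vec a * vec b :: 'f::semiring_1 ^ 3)"
  by (simp add: vec_eq_iff)

lemma vec_1 [simp]: "vec 1 = (1 :: 'f::field ^ 3)"
  by (simp add: vec_eq_iff)

section \<open>Polarised identities of a cyclic composition algebra\<close>

context cyclic_composition_algebra
begin

abbreviation b :: "'v \<Rightarrow> 'v \<Rightarrow> 'f ^ 3" where "b \<equiv> polar Q"

lemma m_add_left [simp]: "m (x + y) z = m x z + m y z"
  and m_add_right [simp]: "m z (x + y) = m z x + m z y"
  and m_diff_left [simp]: "m (x - y) z = m x z - m y z"
  and m_diff_right [simp]: "m z (x - y) = m z x - m z y"
  and m_zero_left [simp]: "m 0 z = 0"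
  and m_zero_right [simp]: "m z 0 = 0"
  and m_sum_left: "m (sum f A) z = (\<Sum>i\<in>A. m (f i) z)"
  and m_sum_right: "m z (sum f A) = (\<Sum>i\<in>A. m z (f i))"
proof -
  interpret l: module_hom "restrict_scalars smul" "restrict_scalars smul" "\<lambda>x. m x z"
    using bilinear_m by (simp add: bilinear_over_def)
  interpret r: module_hom "restrict_scalars smul" "restrict_scalars smul" "m z"
    using bilinear_m by (simp add: bilinear_over_def)
  show "m (x + y) z = m x z + m y z" "m (x - y) z = m x z - m y z" "m 0 z = 0"
    "m (sum f A) z = (\<Sum>i\<in>A. m (f i) z)"
    by (fact l.add l.diff l.zero l.sum)+
  show "m z (x + y) = m z x + m z y" "m z (x - y) = m z x - m z y" "m z 0 = 0"
    "m z (sum f A) = (\<Sum>i\<in>A. m z (f i))"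
    by (fact r.add r.diff r.zero r.sum)+
qed

declare semilinear_left [simp] semilinear_right [simp]

lemma polar_commute: "b x y = b y x"
  by (simp add: polar_def add.commute)

lemma b_add_left [simp]: "b (x + y) z = b x z + b y z"
  and b_diff_left [simp]: "b (x - y) z = b x z - b y z"
  and b_zero_left [simp]: "b 0 z = 0"
  and b_smul_left [simp]: "b (smul l x) z = l * b x z"
  and b_sum_left: "b (sum f A) z = (\<Sum>i\<in>A. b (f i) z)"
proof -
  interpret l: module_hom smul "(*)" "\<lambda>x. b x z"
    using quadratic by (simp add: quadratic_form_def bilinear_over_def)
  show "b (x + y) z = b x z + b y z" "b (x - y) z = b x z - b y z" "b 0 z = 0"
    "b (smul l x) z = l * b x z" "b (sum f A) z = (\<Sum>i\<in>A. b (f i) z)"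
    by (fact l.add l.diff l.zero l.scale l.sum)+
qed

lemma b_add_right [simp]: "b z (x + y) = b z x + b z y"
  and b_diff_right [simp]: "b z (x - y) = b z x - b z y"
  and b_zero_right [simp]: "b z 0 = 0"
  and b_smul_right [simp]: "b z (smul l x) = l * b z x"
  and b_sum_right: "b z (sum f A) = (\<Sum>i\<in>A. b z (f i))"
  by (simp_all add: polar_commute[of z] b_sum_left)

lemma Q_smul [simp]: "Q (smul l x) = l\<^sup>2 * Q x"
  using quadratic by (simp add: quadratic_form_def)

lemma Q_zero [simp]: "Q 0 = 0"
  using Q_smul[of 0 0] by (simp del: Q_smul)

lemma Q_add: "Q (x + y) = Q x + Q y + b x y"
  by (simp add: polar_def)

lemma b_same: "b x x = 2 * Q x"
proof -
  have "x + x = smul 2 x"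
    by (metis one_add_one scale_left_distrib scale_one)
  then show ?thesis by (simp add: polar_def)
qed

lemma eq_if_b_eq: "(\<And>z. b x z = b y z) \<Longrightarrow> x = y"
  using nonsing unfolding nonsingular_def by (metis b_diff_left right_minus_eq)

text \<open>Polarising \<open>Q_m\<close> in the second factor gives b(x*y, x*z) = rho(Q x)
  rho^2(b(y, z)), and cyclicity rewrites the left side as rho^2(b((x*y)*x, z)). As
  \<open>rho\<close> is injective and z is arbitrary, nonsingularity concludes.\<close>

lemma m_m_same_left: "m (m x y) x = smul (rho (rho (Q x))) y"
proof (rule eq_if_b_eq)
  fix z
  have "b (m x y) (m x z) = rho (Q x) * rho (rho (b y z))"
    using Q_m[of x "y + z"] by (simp add: polar_def[of Q] Q_m algebra_simps)
  moreover have "b (m x y) (m x z) = rho (rho (b (m (m x y) x) z))"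
    by (subst polar_commute, subst polar_cyclic2) simp
  ultimately have "rho (rho (b (m (m x y) x) z)) = rho (rho (rho (rho (Q x)) * b y z))"
    by simp
  then show "b (m (m x y) x) z = b (smul (rho (rho (Q x))) y) z"
    by (simp only: rho_eq_iff b_smul_left)
qed

text \<open>Mirror argument: \<open>Q_m\<close> is polarised in the first factor and the other
  cyclic identity is used.\<close>

lemma m_m_same_right: "m x (m y x) = smul (rho (Q x)) y"
proof (rule eq_if_b_eq)
  fix z
  have "b (m y x) (m z x) = rho (b y z) * rho (rho (Q x))"
    using Q_m[of "y + z" x] by (simp add: polar_def[of Q] Q_m algebra_simps)
  moreover have "b (m y x) (m z x) = rho (b (m x (m y x)) z)"
    by (subst polar_commute, subst polar_cyclic1) simp
  ultimately have "rho (b (m x (m y x)) z) = rho (rho (Q x) * b y z)"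
    by simp
  then show "b (m x (m y x)) z = b (smul (rho (Q x)) y) z"
    by (simp only: rho_eq_iff b_smul_left)
qed

text \<open>Linearisation of \<open>m_m_same_left\<close> in the repeated factor.\<close>

lemma m_m_left: "m (m x y) z + m (m z y) x = smul (rho (rho (b x z))) y"
  using m_m_same_left[of "x + z" y]
  by (simp add: Q_add m_m_same_left scale_left_distrib algebra_simps)

lemma m_m_right: "m x (m y z) + m z (m y x) = smul (rho (b x z)) y"
  using m_m_same_right[of "x + z" y]
  by (simp add: Q_add m_m_same_right scale_left_distrib algebra_simps)

lemma rho_cubic [simp]: "rho (b (m x x) x) = b (m x x) x"
  by (metis polar_cyclic1)

text \<open>Put y = x and z = x*x in \<open>m_m_left\<close>. The second summand is ((x*x)*x)*x,
  which collapses to Q(x)(x*x) because rho^3 is the identity.\<close>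

lemma m_square_square:
  "m (m x x) (m x x) = smul (b (m x x) x) x - smul (Q x) (m x x)"
  using m_m_left[of x x "m x x"]
  by (simp add: m_m_same_left polar_commute[of x] algebra_simps)

end

section \<open>The automorphism of order three attached to an idempotent\<close>

locale cyclic_composition_idempotent = cyclic_composition_algebra smul m Q
  for smul :: "('f::field) ^ 3 \<Rightarrow> 'v::ab_group_add \<Rightarrow> 'v" and m Q +
  fixes e
  assumes idem [simp]: "m e e = e" and Q_idem [simp]: "Q e = 1"
begin

text \<open>The analogue of the standard involution, with e in the role of the unit.\<close>

definition cnj :: "'v \<Rightarrow> 'v" where
  "cnj x = smul (b x e) e - x"

lemma m_e_m_e [simp]: "m e (m x e) = x" "m (m e x) e = x"
  by (simp_all add: m_m_same_left m_m_same_right)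

lemma cnj_cnj [simp]: "cnj (cnj x) = x"
  by (simp add: cnj_def b_same algebra_simps flip: scale_left_diff_distrib)

text \<open>Left multiplication by e is applied twice to e*x + (x*e)*e = rho^2(b(x, e)) e. The
  second term becomes x by \<open>m_e_m_e\<close>, and the scalar becomes b(x, e) since rho^6 is the
  identity.\<close>

lemma m_e_thrice: "m e (m e (m e x)) = cnj x"
proof -
  have "m e (m e (m e x + m (m x e) e)) = m e (m e (smul (rho (rho (b x e))) e))"
    using m_m_left[of e e x] by (simp add: polar_commute)
  then show ?thesis
    by (simp add: cnj_def algebra_simps)
qed

lemma m_e_mult: "m e (m x y) = m (cnj y) (m x e)"
  using m_m_right[of y x e] by (simp add: cnj_def polar_commute algebra_simps)

text \<open>Left multiplication by e cubes to the involution \<open>cnj\<close>, so its square cubes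
  to the identity. It is \<open>rho\<close>-semilinear because rho^4 = rho.\<close>

definition aut :: "'v \<Rightarrow> 'v" where
  "aut x = m e (m e x)"

lemma aut_aut_aut [simp]: "aut (aut (aut x)) = x"
  by (simp add: aut_def m_e_thrice)

lemma aut_eq: "m (cnj x) e = aut x"
  by (simp add: aut_def flip: m_e_thrice)

lemma cnj_m_e: "cnj (m x e) = aut x"
  by (simp add: aut_def flip: m_e_thrice)

text \<open>Two uses of \<open>m_e_mult\<close> give e*(e*(x*y)) = e*(cnj y * (x*e)) = cnj(x*e) *
  (cnj y * e), whose factors are the images of x and y.\<close>

lemma aut_m [simp]: "aut (m x y) = m (aut x) (aut y)"
  by (simp add: aut_def[of "m x y"] m_e_mult cnj_m_e aut_eq)

lemma aut_smul [simp]: "aut (smul l x) = smul (rho l) (aut x)"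
  by (simp add: aut_def)

lemma aut_add [simp]: "aut (x + y) = aut x + aut y"
  and aut_zero [simp]: "aut 0 = 0"
  by (simp_all add: aut_def)

lemma Q_aut [simp]: "Q (aut x) = rho (Q x)"
  by (simp add: aut_def Q_m)

lemma aut_e [simp]: "aut e = e"
  by (simp add: aut_def)

text \<open>For fixed x, e*x equals e*(e*(e*x)), which is \<open>cnj x\<close>; the other side comes
  from \<open>cnj_m_e\<close>.\<close>

lemma aut_fixed_para_unit:
  assumes "aut x = x" shows "m e x = cnj x" "m x e = cnj x"
proof -
  show "m e x = cnj x"
    using assms by (simp add: aut_def flip: m_e_thrice)
  show "m x e = cnj x"
    using assms by (metis cnj_cnj cnj_m_e)
qed

end

section \<open>Gradings of Type III\<close>

locale graded_space = vector_space smul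
  for smul :: "'f::field \<Rightarrow> 'a::ab_group_add \<Rightarrow> 'a" +
  fixes A :: "'g \<Rightarrow> 'a set"
  assumes grading: "vector_grading smul A"
begin

definition proj :: "'a \<Rightarrow> 'g \<Rightarrow> 'a" where
  "proj x = (THE c. (\<forall>g. c g \<in> A g) \<and> finite {g. c g \<noteq> 0} \<and> x = (\<Sum>g | c g \<noteq> 0. c g))"

lemma subspace_A: "subspace (A g)"
  using grading by (simp add: vector_grading_def)

lemma zero_A [simp]: "0 \<in> A g"
  by (simp add: subspace_0 subspace_A)

lemma ex1_proj: "\<exists>!c. (\<forall>g. c g \<in> A g) \<and> finite {g. c g \<noteq> 0} \<and> x = (\<Sum>g | c g \<noteq> 0. c g)"
  using grading by (simp add: vector_grading_def)

lemma proj_in [simp]: "proj x g \<in> A g"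
  and finite_proj [simp]: "finite {g. proj x g \<noteq> 0}"
  and sum_proj: "(\<Sum>g | proj x g \<noteq> 0. proj x g) = x"
  using theI'[OF ex1_proj, of x] unfolding proj_def by auto

text \<open>Components are computed through this form of uniqueness, where K may be any finite set
  containing the support.\<close>

lemma proj_unique:
  assumes "\<And>g. c g \<in> A g" and "finite K" and "\<And>g. g \<notin> K \<Longrightarrow> c g = 0" and "x = sum c K"
  shows "proj x = c"
proof -
  have sub: "{g. c g \<noteq> 0} \<subseteq> K"
    using assms(3) by auto
  have "sum c K = (\<Sum>g | c g \<noteq> 0. c g)"
    using sub by (intro sum.mono_neutral_right) (auto simp: assms(2))
  moreover have "finite {g. c g \<noteq> 0}"
    using sub assms(2) finite_subset by blast
  ultimately show ?thesis
    unfolding proj_def using assms by (intro the1_equality ex1_proj) auto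
qed

lemma sum_proj_superset:
  assumes "finite K" and "{g. proj x g \<noteq> 0} \<subseteq> K"
  shows "(\<Sum>g\<in>K. proj x g) = x"
proof -
  have "(\<Sum>g\<in>K. proj x g) = (\<Sum>g | proj x g \<noteq> 0. proj x g)"
    by (rule sum.mono_neutral_right) (use assms in auto)
  then show ?thesis by (simp add: sum_proj)
qed

lemma proj_homogeneous:
  assumes "x \<in> A k" shows "proj x = (\<lambda>g. if g = k then x else 0)"
  by (rule proj_unique[where K = "{k}"]) (use assms in auto)

lemma proj_add: "proj (x + y) g = proj x g + proj y g"
proof -
  define K where "K = {g. proj x g \<noteq> 0} \<union> {g. proj y g \<noteq> 0}"
  have [simp]: "finite K" by (simp add: K_def)
  have "proj (x + y) = (\<lambda>g. proj x g + proj y g)"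
  proof (rule proj_unique[of _ K])
    have "sum (proj x) K = x" "sum (proj y) K = y"
      by (rule sum_proj_superset; auto simp: K_def)+
    then show "x + y = (\<Sum>g\<in>K. proj x g + proj y g)"
      by (simp add: sum.distrib)
  qed (auto simp: K_def intro: subspace_add[OF subspace_A])
  then show ?thesis by simp
qed

lemma proj_zero [simp]: "proj 0 g = 0"
  using proj_homogeneous[of 0 g] by simp

lemma proj_uminus: "proj (- x) g = - proj x g"
  using proj_add[of x "- x" g] by (simp add: eq_neg_iff_add_eq_0 add.commute)

lemma proj_diff: "proj (x - y) g = proj x g - proj y g"
  using proj_add[of x "- y" g] by (simp add: proj_uminus)

lemma proj_scale: "proj (smul c x) g = smul c (proj x g)"
proof -
  have "proj (smul c x) = (\<lambda>g. smul c (proj x g))"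
    by (rule proj_unique[where K = "{g. proj x g \<noteq> 0}"])
      (auto simp: sum_proj subspace_scale[OF subspace_A] simp flip: scale_sum_right)
  then show ?thesis by simp
qed

lemma proj_sum: "proj (sum f K) g = (\<Sum>k\<in>K. proj (f k) g)"
  by (induction K rule: infinite_finite_induct) (auto simp: proj_add)

lemma homogeneous_induct:
  assumes "\<And>g x. x \<in> A g \<Longrightarrow> P x" and "\<And>x y. P x \<Longrightarrow> P y \<Longrightarrow> P (x + y)"
  shows "P x"
proof -
  have P0: "P 0" using assms(1)[OF zero_A] .
  have "P (sum (proj x) K)" for K
    by (induction K rule: infinite_finite_induct) (auto intro: P0 assms proj_in)
  then show ?thesis by (metis sum_proj)
qed

lemma disjoint_degrees:
  assumes "x \<in> A g" and "x \<in> A k" and "x \<noteq> 0" shows "g = k"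
  using proj_homogeneous[OF assms(1)] proj_homogeneous[OF assms(2)] assms(3)
  by (metis (full_types))

end

section \<open>The graded algebra F x F x F and its action on V\<close>

locale type_III_algebra = cyclic_composition_algebra smul m Q
  for smul :: "('f::field) ^ 3 \<Rightarrow> 'v::ab_group_add \<Rightarrow> 'v" and m Q +
  fixes V :: "'g::ab_group_add \<Rightarrow> 'v set" and L :: "'g \<Rightarrow> ('f ^ 3) set"
    and w :: 'f and h :: 'g and xi :: "'f ^ 3"
  assumes two: "(2::'f) \<noteq> 0" and three: "(3::'f) \<noteq> 0"
    and cc_grading: "cyclic_composition_grading smul m Q V L"
    and w_cubed: "w ^ 3 = 1" and w_neq_1: "w \<noteq> 1"
    and h_neq_0: "h \<noteq> 0" and h_thrice: "h + h + h = 0"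
    and xi_def: "xi = vector [1, w, w\<^sup>2]"
    and L_0: "L 0 = range vec"
    and L_h: "L h = range (\<lambda>a. vec a * xi)"
    and L_2h: "L (h + h) = range (\<lambda>a. vec a * (xi * xi))"
begin

lemma w_sum: "1 + w + w\<^sup>2 = 0"
proof -
  have "(w - 1) * (1 + w + w\<^sup>2) = 0"
    using w_cubed by (simp add: algebra_simps power2_eq_square power3_eq_cube)
  then show ?thesis using w_neq_1 by simp
qed

lemma xi_nth [simp]: "xi $ 1 = 1" "xi $ 2 = w" "xi $ 3 = w\<^sup>2"
  by (simp_all add: xi_def vector_3)

lemma xi_cubed: "xi * (xi * xi) = 1"
proof -
  have "w * (w * w) = 1" "w\<^sup>2 * (w\<^sup>2 * w\<^sup>2) = 1"
    using w_cubed by (simp_all add: power3_eq_cube power2_eq_square mult.assoc)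
  then show ?thesis by (simp add: vec_eq_iff forall_3)
qed

lemma rho_xi [simp]: "rho xi = vec w * xi"
proof -
  have "w * (w * w) = 1"
    using w_cubed by (simp add: power3_eq_cube mult.assoc)
  then show ?thesis
    using rho_vector[of 1 w "w\<^sup>2"] by (simp add: xi_def vec_eq_iff forall_3 vector_3 power2_eq_square)
qed

lemma xi_independent:
  assumes "vec a + vec c * xi + vec d * (xi * xi) = 0" shows "a = 0" "c = 0" "d = 0"
proof -
  have "(vec a + vec c * xi + vec d * (xi * xi)) $ i = 0" for i
    using assms by simp
  from this[of 1] this[of 2] this[of 3]
  have 1: "a + c + d = 0" and 2: "a + c * w + d * w\<^sup>2 = 0" and 3: "a + c * w\<^sup>2 + d * w ^ 4 = 0"
    by (simp_all add: power2_eq_square power4_eq_xxxx mult.assoc)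
  have w4: "w ^ 4 = w"
    using w_cubed by (simp add: power4_eq_xxxx power3_eq_cube)
  \<comment> \<open>Adding the three coordinates leaves 3a plus (c + d)(1 + w + w^2), and the last
    factor is zero.\<close>
  have "3 * a = (a + c + d) + (a + c * w + d * w\<^sup>2) + (a + c * w\<^sup>2 + d * w ^ 4)
      - (c + d) * (1 + w + w\<^sup>2)"
    unfolding w4 by (simp add: algebra_simps)
  then have "3 * a = 0" by (simp only: 1 2 3 w_sum) simp
  then show a: "a = 0" using three by simp
  have "w \<noteq> 0" using w_cubed by auto
  have d: "d = - c" using 1 a by (simp add: eq_neg_iff_add_eq_0 add.commute)
  have "c * (w * (1 - w)) = 0"
    using 2 a d by (simp add: algebra_simps power2_eq_square)
  then show c: "c = 0" using \<open>w \<noteq> 0\<close> w_neq_1 by simp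
  then show "d = 0" using d by simp
qed

lemma vec_plus: "vec (a + c) = (vec a + vec c :: 'f ^ 3)"
  by (simp add: vec_eq_iff)

sublocale F: vector_space "restrict_scalars smul"
  by unfold_locales
    (simp_all add: restrict_scalars_def scale_right_distrib scale_left_distrib vec_mult vec_plus)

sublocale V: graded_space "restrict_scalars smul" V
  using cc_grading
  by unfold_locales (simp add: cyclic_composition_grading_def algebra_grading_def)

sublocale L: graded_space "vector_scalar_mult :: 'f \<Rightarrow> 'f ^ 3 \<Rightarrow> 'f ^ 3" L
  using cc_grading
  by unfold_locales (auto simp: cyclic_composition_grading_def algebra_grading_def vec_eq_iff algebra_simps)

lemma V_add: "x \<in> V g \<Longrightarrow> y \<in> V g \<Longrightarrow> x + y \<in> V g"
  and V_vec: "x \<in> V g \<Longrightarrow> smul (vec a) x \<in> V g"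
  using F.subspace_add[OF V.subspace_A]
    F.subspace_scale[OF V.subspace_A] by (auto simp: restrict_scalars_def)

lemma V_m: "x \<in> V g \<Longrightarrow> y \<in> V k \<Longrightarrow> m x y \<in> V (g + k)"
  and V_smul: "l \<in> L g \<Longrightarrow> x \<in> V k \<Longrightarrow> smul l x \<in> V (g + k)"
  and L_b: "x \<in> V g \<Longrightarrow> y \<in> V k \<Longrightarrow> b x y \<in> L (g + k)"
  using cc_grading by (auto simp: cyclic_composition_grading_def algebra_grading_def)

lemma vec_in_L: "vec a \<in> L 0"
  using L_0 by auto

lemma xi_in_L: "xi \<in> L h"
  unfolding L_h by (rule range_eqI[of _ _ 1]) simp

lemma xi_xi_in_L: "xi * xi \<in> L (h + h)"
  unfolding L_2h by (rule range_eqI[of _ _ 1]) simp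

lemma h_sums: "h + h \<noteq> 0" "h + h \<noteq> h" "- h = h + h" "- (h + h) = h"
  using h_neq_0 h_thrice by (auto simp: add.assoc minus_unique)

lemma L_decomp: obtains a c d where "l = vec a + vec c * xi + vec d * (xi * xi)"
proof -
  \<comment> \<open>Inverse discrete Fourier transform on three points; this is where 3 must be
    invertible.\<close>
  define a c d where "a = (l$1 + l$2 + l$3) / 3" and "c = (l$1 + w\<^sup>2 * l$2 + w * l$3) / 3"
    and "d = (l$1 + w * l$2 + w\<^sup>2 * l$3) / 3"
  then have acd: "a * 3 = l$1 + l$2 + l$3" "c * 3 = l$1 + w\<^sup>2 * l$2 + w * l$3"
    "d * 3 = l$1 + w * l$2 + w\<^sup>2 * l$3"
    using three by simp_all
  have "(1 + w) + w * w = 0"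
    using w_sum by (simp add: power2_eq_square)
  then have w2: "w * w = - (1 + w)"
    by (metis minus_unique)
  then have w2': "w * (w * z) = - (1 + w) * z" for z
    by (metis mult.assoc)
  have "l$1 * 3 = a * 3 + c * 3 + d * 3"
    "l$2 * 3 = a * 3 + c * 3 * w + d * 3 * (w * w)"
    "l$3 * 3 = a * 3 + c * 3 * (w * w) + d * 3 * (w * w * (w * w))"
    unfolding acd by (simp_all add: power2_eq_square algebra_simps w2 w2')
  then have "l$1 * 3 = (a + c + d) * 3"
    "l$2 * 3 = (a + c * w + d * (w * w)) * 3"
    "l$3 * 3 = (a + c * (w * w) + d * (w * w * (w * w))) * 3"
    by (simp_all add: algebra_simps)
  then have "l = vec a + vec c * xi + vec d * (xi * xi)"
    using three by (simp only: mult_cancel_right vec_eq_iff forall_3) (simp add: power2_eq_square)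
  then show ?thesis by (rule that)
qed

text \<open>By \<open>L_decomp\<close> the three known lines span everything, so the projection to
  any other degree vanishes.\<close>

lemma L_degrees:
  assumes "l \<in> L k" and "l \<noteq> 0" shows "k = 0 \<or> k = h \<or> k = h + h"
proof (rule ccontr)
  assume k: "\<not> ?thesis"
  obtain a c d where l: "l = vec a + vec c * xi + vec d * (xi * xi)"
    by (rule L_decomp)
  have "L.proj (vec a + vec c * xi + vec d * (xi * xi)) k = 0"
    using k L.proj_homogeneous[OF vec_in_L, of a] L.proj_homogeneous[of "vec c * xi" h]
      L.proj_homogeneous[of "vec d * (xi * xi)" "h + h"]
    by (simp add: L.proj_add L_h L_2h)
  moreover have "L.proj l k = l"
    using L.proj_homogeneous[OF assms(1)] by simp
  ultimately show False using l assms(2) by simp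
qed

text \<open>L is a graded field: a nonzero multiple of a power of xi is inverted by means of xi^3 =
  1. This allows homogeneous values of b and Q to be cancelled.\<close>

lemma L_unit:
  assumes "l \<in> L k" and "l \<noteq> 0" obtains l' where "l' \<in> L (- k)" and "l' * l = 1"
proof -
  consider a where "k = 0" "l = vec a" | a where "k = h" "l = vec a * xi"
    | a where "k = h + h" "l = vec a * (xi * xi)"
    using L_degrees[OF assms] assms(1) L_0 L_h L_2h by auto
  then show thesis
  proof cases
    case 1
    then have "a \<noteq> 0" using assms(2) by auto
    then show ?thesis using that[of "vec (1 / a)"] 1 by (simp add: vec_in_L flip: vec_mult)
  next
    case 2
    then have "a \<noteq> 0" using assms(2) by auto
    then show ?thesis
      using that[of "vec (1 / a) * (xi * xi)"] 2 xi_cubed by (simp add: h_sums L_2h mult_ac) (simp flip: vec_mult mult.assoc)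
  next
    case 3
    then have "a \<noteq> 0" using assms(2) by auto
    then show ?thesis
      using that[of "vec (1 / a) * xi"] 3 xi_cubed
      by (simp add: h_sums(4) L_h mult_ac del: minus_add_distrib) (simp flip: vec_mult mult.assoc)
  qed
qed

text \<open>Nonsingularity gives a homogeneous vector pairing nontrivially with x. The value is a
  unit of L, and multiplying that vector by the homogeneous inverse puts it in degree -g.\<close>

lemma homogeneous_pairing:
  assumes "x \<in> V g" and "x \<noteq> 0" obtains y where "y \<in> V (- g)" and "b x y = 1"
proof -
  have "\<exists>k. \<exists>y\<in>V k. b x y \<noteq> 0"
  proof (rule ccontr)
    assume *: "\<not> ?thesis"
    have "b x y = 0" for y
      by (induction y rule: V.homogeneous_induct) (use * in auto)
    then show False using nonsing assms(2) by (auto simp: nonsingular_def)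
  qed
  then obtain k y where y: "y \<in> V k" "b x y \<noteq> 0" by auto
  obtain l where l: "l \<in> L (- (g + k))" "l * b x y = 1"
    using L_unit[OF L_b[OF assms(1) y(1)] y(2)] by blast
  then show ?thesis
    using that[of "smul l y"] V_smul[OF l(1) y(1)] by simp
qed

text \<open>The degree condition on b passes to Q because b(x, x) = 2 Q(x) and 2 is
  invertible.\<close>

lemma Q_homogeneous:
  assumes "x \<in> V g" shows "Q x \<in> L (g + g)"
proof -
  have "Q x = (1/2) *s b x x"
    using two by (simp add: b_same vec_eq_iff)
  then show ?thesis
    using L_b[OF assms assms] vec.subspace_scale[OF L.subspace_A] by simp
qed

end

section \<open>Descent to a form over the field\<close>

lemma bilinear_overI:
  assumes "module sa" "module sb" "module sc"
    and "\<And>x y z. f (x + y) z = f x z + f y z" and "\<And>x y z. f z (x + y) = f z x + f z y"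
    and "\<And>c x z. f (sa c x) z = sc c (f x z)" and "\<And>c x z. f z (sb c x) = sc c (f z x)"
  shows "bilinear_over sa sb sc f"
  using assms by (auto simp: bilinear_over_def intro!: module_hom.intro module_hom_axioms.intro)

lemma module_times: "module ((*) :: 'f::comm_ring_1 \<Rightarrow> _)"
  by unfold_locales (simp_all add: algebra_simps)

lemma module_tensor_scale:
  "vector_space smul \<Longrightarrow> module (restrict_scalars (tensor_scale smul))"
  using bilinear_tensor[of smul] by (auto simp: bilinear_over_def module_hom_def)

lemma rho_axis:
  "rho (axis (j + 1) 1) = (axis j 1 :: 'f::field ^ 3)"
  "rho (rho (axis (j + 2) 1)) = (axis j 1 :: 'f::field ^ 3)"
proof -
  have "i + 1 = j + 1 \<longleftrightarrow> i = j" "i + 1 + 1 = j + 2 \<longleftrightarrow> i = j" for i :: 3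
    by (simp_all add: add.assoc)
  then show "rho (axis (j + 1) 1) = (axis j 1 :: 'f ^ 3)"
    "rho (rho (axis (j + 2) 1)) = (axis j 1 :: 'f ^ 3)"
    by (simp_all only: vec_eq_iff rho_component axis_def vec_lambda_beta) simp_all
qed

lemma axis_mult: "axis j c * l = (axis j (c * l $ j) :: 'f::field ^ 3)"
  and mult_axis: "l * axis j c = (axis j (l $ j * c) :: 'f::field ^ 3)"
  by (simp_all add: vec_eq_iff axis_def)

text \<open>\<open>S\<close> is a form in the sense of the introduction. The \<open>L\<close>-basis
  \<open>bas\<close> need not be homogeneous or lie in \<open>S\<close>; it serves to identify
  \<open>S\<close> with F^8, so that the descended algebra lives on a fixed type.\<close>

locale descent = type_III_algebra smul m Q V L w h xi
  for smul :: "('f::field) ^ 3 \<Rightarrow> 'v::ab_group_add \<Rightarrow> 'v" and m Q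
    and V :: "'g::ab_group_add \<Rightarrow> 'v set" and L w h xi +
  fixes S :: "'v set" and bas :: "8 \<Rightarrow> 'v"
  assumes S_subspace: "module.subspace (restrict_scalars smul) S"
    and S_m: "x \<in> S \<Longrightarrow> y \<in> S \<Longrightarrow> m x y \<in> S"
    and S_Q: "x \<in> S \<Longrightarrow> \<exists>a. Q x = vec a"
    and S_split: "x \<in> V g \<Longrightarrow> \<exists>s0 s1 s2. s0 \<in> S \<inter> V g \<and> s1 \<in> S \<inter> V (g - h) \<and>
          s2 \<in> S \<inter> V (g - (h + h)) \<and> x = s0 + smul xi s1 + smul (xi * xi) s2"
    and bas_span: "\<exists>l. x = (\<Sum>i\<in>UNIV. smul (l i) (bas i))"
    and bas_indep: "(\<Sum>i\<in>UNIV. smul (l i) (bas i)) = 0 \<Longrightarrow> l i = 0"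
begin

lemma S_add: "x \<in> S \<Longrightarrow> y \<in> S \<Longrightarrow> x + y \<in> S"
  and S_diff: "x \<in> S \<Longrightarrow> y \<in> S \<Longrightarrow> x - y \<in> S"
  and S_vec: "x \<in> S \<Longrightarrow> smul (vec a) x \<in> S"
  and S_zero: "0 \<in> S"
  using F.subspace_add[OF S_subspace] F.subspace_diff[OF S_subspace] F.subspace_0[OF S_subspace]
    F.subspace_scale[OF S_subspace] unfolding restrict_scalars_def by blast+

lemma S_b: assumes "x \<in> S" "y \<in> S" shows "\<exists>a. b x y = vec a"
proof -
  obtain p q r where "Q (x + y) = vec p" "Q x = vec q" "Q y = vec r"
    using S_Q[OF S_add[OF assms]] S_Q[OF assms(1)] S_Q[OF assms(2)] by blast
  then have "b x y = vec (p - q - r)" by (simp add: polar_def vec_eq_iff)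
  then show ?thesis by blast
qed

lemma S_span: "\<exists>s0\<in>S. \<exists>s1\<in>S. \<exists>s2\<in>S. x = s0 + smul xi s1 + smul (xi * xi) s2"
proof (induction x rule: V.homogeneous_induct)
  case (1 g x)
  then show ?case using S_split[of x g] by blast
next
  case (2 x y)
  then obtain s0 s1 s2 t0 t1 t2 where "{s0, s1, s2, t0, t1, t2} \<subseteq> S"
    "x = s0 + smul xi s1 + smul (xi * xi) s2" "y = t0 + smul xi t1 + smul (xi * xi) t2"
    by auto
  then show ?case
    by (intro bexI[of _ "s0 + t0"] bexI[of _ "s1 + t1"] bexI[of _ "s2 + t2"])
      (auto simp: algebra_simps intro: S_add)
qed

text \<open>Since \<open>S\<close> spans V over L, orthogonality to \<open>S\<close> is
  orthogonality to V.\<close>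

lemma S_eq_0:
  assumes "x \<in> S" and "\<And>t. t \<in> S \<Longrightarrow> b x t = 0" shows "x = 0"
proof (rule eq_if_b_eq)
  fix z
  obtain s0 s1 s2 where "s0 \<in> S" "s1 \<in> S" "s2 \<in> S" "z = s0 + smul xi s1 + smul (xi * xi) s2"
    using S_span by blast
  then show "b x z = b 0 z" using assms by simp
qed

text \<open>Pairing the relation with t in \<open>S\<close> gives an F-linear relation between 1, xi
  and xi^2, because b takes scalar values on \<open>S\<close>.\<close>

lemma S_direct:
  assumes "s0 \<in> S" "s1 \<in> S" "s2 \<in> S" "s0 + smul xi s1 + smul (xi * xi) s2 = 0"
  shows "s0 = 0" "s1 = 0" "s2 = 0"
proof -
  have "b s0 t = 0 \<and> b s1 t = 0 \<and> b s2 t = 0" if t: "t \<in> S" for t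
  proof -
    obtain p q r where pqr: "b s0 t = vec p" "b s1 t = vec q" "b s2 t = vec r"
      using S_b[OF assms(1) t] S_b[OF assms(2) t] S_b[OF assms(3) t] by blast
    have "b (s0 + smul xi s1 + smul (xi * xi) s2) t = 0" using assms by simp
    then have "vec p + vec q * xi + vec r * (xi * xi) = 0"
      by (simp add: pqr mult_ac)
    from xi_independent[OF this] show ?thesis using pqr by simp
  qed
  then show "s0 = 0" "s1 = 0" "s2 = 0"
    using S_eq_0[OF assms(1)] S_eq_0[OF assms(2)] S_eq_0[OF assms(3)] by auto
qed

text \<open>Each component of s is split by \<open>S_split\<close>. Summing up, directness gives s =
  sum of the \<open>s0 g\<close>; these lie in \<open>S\<close> and have degree g, so they are the
  components of s.\<close>

lemma S_proj: assumes "s \<in> S" shows "V.proj s g \<in> S"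
proof -
  define K where "K = {g. V.proj s g \<noteq> 0}"
  have finite_K: "finite K" by (simp add: K_def)
  have "\<forall>g. \<exists>s0 s1 s2. s0 \<in> S \<inter> V g \<and> s1 \<in> S \<and> s2 \<in> S \<and> V.proj s g = s0 + smul xi s1 + smul (xi * xi) s2"
    using S_split[OF V.proj_in] by blast
  then obtain s0 s1 s2 where s: "\<And>g. s0 g \<in> S \<inter> V g" "\<And>g. s1 g \<in> S" "\<And>g. s2 g \<in> S"
    "\<And>g. V.proj s g = s0 g + smul xi (s1 g) + smul (xi * xi) (s2 g)"
    by metis
  have "s = (\<Sum>g\<in>K. V.proj s g)"
    by (simp add: K_def V.sum_proj)
  also have "\<dots> = sum s0 K + smul xi (sum s1 K) + smul (xi * xi) (sum s2 K)"
    by (simp add: s(4) sum.distrib scale_sum_right)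
  finally have "(sum s0 K - s) + smul xi (sum s1 K) + smul (xi * xi) (sum s2 K) = 0"
    by (simp add: algebra_simps)
  moreover have "sum s0 K \<in> S" "sum s1 K \<in> S" "sum s2 K \<in> S"
    using s by (auto intro: F.subspace_sum[OF S_subspace])
  ultimately have "s = sum s0 K"
    using S_direct(1)[of "sum s0 K - s"] assms S_diff by auto
  then have "V.proj s = (\<lambda>g. if g \<in> K then s0 g else 0)"
    using s(1) by (intro V.proj_unique[where K = K]) (auto simp: finite_K)
  then have "V.proj s g = (if g \<in> K then s0 g else 0)" by metis
  then show ?thesis using s(1)[of g] S_zero by simp
qed

text \<open>The coordinate idempotents \<open>axis j 1\<close> sum to 1, so vectors can be compared
  block by block.\<close>

lemma axis_ext: "(\<And>j. smul (axis j 1) x = smul (axis j 1) y) \<Longrightarrow> x = y"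
proof -
  assume *: "\<And>j. smul (axis j 1) x = smul (axis j 1) y"
  have "(1 :: 'f ^ 3) = (\<Sum>j\<in>UNIV. axis j 1)"
    by (simp add: vec_eq_iff axis_def)
  then have "x = (\<Sum>j\<in>UNIV. smul (axis j 1) x)" "y = (\<Sum>j\<in>UNIV. smul (axis j 1) y)"
    by (metis scale_one scale_sum_left)+
  then show ?thesis using * by simp
qed

lemma smul_axis_S: "smul (axis j 1) (smul l x) = smul (axis j 1) (smul (vec (l $ j)) x)"
  by (simp add: axis_mult)

text \<open>With the next lemma, each block of V is a copy of \<open>S\<close>. Injectivity holds
  because a scalar value of b is determined by any one coordinate.\<close>

lemma S_axis_inj: assumes "s \<in> S" "t \<in> S" "smul (axis j 1) s = smul (axis j 1) t" shows "s = t"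
proof -
  have "s - t = 0"
  proof (rule S_eq_0)
    fix z assume "z \<in> S"
    then obtain a where a: "b (s - t) z = vec a" using S_b[OF S_diff[OF assms(1,2)]] by blast
    have "axis j 1 * b (s - t) z = b (smul (axis j 1) s - smul (axis j 1) t) z"
      by (simp add: algebra_simps)
    then have "axis j 1 * vec a = (0 :: 'f ^ 3)" using a assms by simp
    then show "b (s - t) z = 0" using a by (simp add: axis_mult axis_eq_0_iff)
  qed (use assms S_diff in auto)
  then show ?thesis by simp
qed

text \<open>On block j, xi acts as the scalar \<open>xi $ j\<close>, so s0 + xi s1 + xi^2 s2 may be
  replaced by an F-combination inside \<open>S\<close>.\<close>

lemma S_axis_surj: obtains s where "s \<in> S" "smul (axis j 1) x = smul (axis j 1) s"
proof -
  obtain s0 s1 s2 where s: "s0 \<in> S" "s1 \<in> S" "s2 \<in> S" "x = s0 + smul xi s1 + smul (xi * xi) s2"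
    using S_span by blast
  have "smul (axis j 1) x = smul (axis j 1) (s0 + smul (vec (xi $ j)) s1 + smul (vec ((xi * xi) $ j)) s2)"
    unfolding s(4) scale_right_distrib smul_axis_S[of j xi] smul_axis_S[of j "xi * xi"] ..
  then show ?thesis using s that S_add S_vec by metis
qed

section \<open>Transport of the form to F^8\<close>

definition psi :: "'f ^ 8 \<Rightarrow> 'v" where
  "psi a = (\<Sum>i\<in>UNIV. smul (axis 1 (a $ i)) (bas i))"

text \<open>Both \<open>F\<^sup>8\<close> (through \<open>psi\<close>) and \<open>S\<close> are isomorphic to \<open>(1, 0, 0) V\<close>.\<close>

definition theta :: "'f ^ 8 \<Rightarrow> 'v" where
  "theta a = (THE s. s \<in> S \<and> smul (axis 1 1) s = psi a)"

lemma psi_axis: "psi a = smul (axis 1 1) (\<Sum>i\<in>UNIV. smul (vec (a $ i)) (bas i))"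
  by (simp add: psi_def scale_sum_right axis_mult)

lemma theta: "theta a \<in> S" "smul (axis 1 1) (theta a) = psi a"
proof -
  obtain s where "s \<in> S" "psi a = smul (axis 1 1) s"
    unfolding psi_axis by (rule S_axis_surj)
  then have "\<exists>!s. s \<in> S \<and> smul (axis 1 1) s = psi a"
    using S_axis_inj by metis
  from theI'[OF this] show "theta a \<in> S" "smul (axis 1 1) (theta a) = psi a"
    by (auto simp: theta_def)
qed

lemma theta_unique: "s \<in> S \<Longrightarrow> smul (axis 1 1) s = psi a \<Longrightarrow> theta a = s"
  using theta S_axis_inj by metis

lemma axis_plus: "axis j (x + y) = (axis j x + axis j y :: 'f ^ 3)"
  by (simp add: vec_eq_iff axis_def)

lemma theta_add [simp]: "theta (x + y) = theta x + theta y"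
  by (rule theta_unique)
    (simp_all add: S_add theta scale_right_distrib psi_def axis_plus scale_left_distrib sum.distrib)

lemma theta_scale [simp]: "theta (c *s x) = smul (vec c) (theta x)"
proof (rule theta_unique)
  have "smul (axis 1 1) (smul (vec c) (theta x)) = smul (vec c) (psi x)"
    by (metis scale_left_commute theta(2))
  then show "smul (axis 1 1) (smul (vec c) (theta x)) = psi (c *s x)"
    by (simp add: psi_def scale_sum_right mult_axis)
qed (simp add: S_vec theta)

lemma theta_diff [simp]: "theta (x - y) = theta x - theta y"
  using theta_add[of "x - y" y] by (simp add: algebra_simps)

lemma theta_eq_iff [simp]: "theta x = theta y \<longleftrightarrow> x = y"
proof
  assume "theta x = theta y"
  then have "psi (x - y) = 0" using theta(2)[of "x - y"] by simp
  then have "axis 1 ((x - y) $ i) = (0 :: 'f ^ 3)" for i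
    unfolding psi_def by (rule bas_indep)
  then have "x $ i = y $ i" for i by (simp add: axis_eq_0_iff)
  then show "x = y" by (simp add: vec_eq_iff)
qed simp

lemma theta_zero [simp]: "theta 0 = 0"
  using theta_add[of 0 0] by (simp del: theta_add)

lemma theta_surj: assumes "s \<in> S" obtains a where "theta a = s"
proof -
  obtain l where l: "s = (\<Sum>i\<in>UNIV. smul (l i) (bas i))" using bas_span by blast
  have "smul (axis 1 1) s = psi (\<chi> i. l i $ 1)"
    unfolding l by (simp add: psi_def scale_sum_right axis_mult)
  then show ?thesis using that theta_unique assms by blast
qed

definition eta :: "'v \<Rightarrow> 'f ^ 8" where "eta = inv theta"

lemma theta_eta [simp]: "s \<in> S \<Longrightarrow> theta (eta s) = s"
  unfolding eta_def by (metis theta_surj f_inv_into_f rangeI)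

lemma eta_theta [simp]: "eta (theta a) = a"
  using theta by (metis theta_eta theta_eq_iff)

definition star :: "'f ^ 8 \<Rightarrow> 'f ^ 8 \<Rightarrow> 'f ^ 8" where
  "star x y = eta (m (theta x) (theta y))"

text \<open>On \<open>S\<close> the value of Q is a constant triple, so any coordinate of it would
  do.\<close>

definition nrm :: "'f ^ 8 \<Rightarrow> 'f" where
  "nrm x = Q (theta x) $ 1"

definition Sgr :: "'g \<Rightarrow> ('f ^ 8) set" where
  "Sgr g = {x. theta x \<in> V g}"

lemma theta_star [simp]: "theta (star x y) = m (theta x) (theta y)"
  by (simp add: star_def S_m theta)

lemma Q_theta: "Q (theta x) = vec (nrm x)"
  using S_Q[OF theta(1)[of x]] by (auto simp: nrm_def)

lemma b_theta: "b (theta x) (theta y) = vec (polar nrm x y)"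
  by (simp add: polar_def Q_theta vec_eq_iff flip: theta_add)

lemma vec_eq_vec_iff [simp]: "(vec x :: 'f ^ 3) = vec y \<longleftrightarrow> x = y"
  by (simp add: vec_eq_iff)

sublocale star: symmetric_composition_algebra vector_scalar_mult star nrm
proof unfold_locales
  show "\<exists>B. finite B \<and> vec.span B = (UNIV :: ('f ^ 8) set)"
    using vec.finite_Basis vec.span_Basis by blast
  show "bilinear_over (*s) (*s) (*s) star"
    by (rule bilinear_overI)
      (auto simp: vec.module_axioms simp flip: theta_eq_iff)
  have "nrm (c *s x) = c\<^sup>2 * nrm x" for c x
    using Q_smul[of "vec c" "theta x"] by (simp add: nrm_def power2_eq_square del: Q_smul)
  moreover have "bilinear_over (*s) (*s) (*) (polar nrm)"
    by (rule bilinear_overI)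
      (auto simp: vec.module_axioms module_times vec_plus vec_mult simp flip: vec_eq_vec_iff b_theta)
  ultimately show "quadratic_form (*s) nrm"
    by (simp add: quadratic_form_def)
  show "nonsingular nrm"
    unfolding nonsingular_def
  proof (intro allI impI)
    fix x assume "\<forall>y. polar nrm x y = 0"
    then have "b (theta x) (theta y) = 0" for y by (simp add: b_theta)
    then have "theta x = 0" by (intro S_eq_0 theta) (metis theta_surj)
    then show "x = 0" using theta_eq_iff[of x 0] by simp
  qed
  show "nrm (star x y) = nrm x * nrm y" for x y
    using Q_m[of "theta x" "theta y"] Q_theta[of "star x y"] by (simp add: Q_theta flip: vec_mult)
  show "polar nrm (star x y) z = polar nrm x (star y z)" for x y z
  proof -
    \<comment> \<open>Cyclicity gives associativity of the polar form up to \<open>rho\<close>,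
      which fixes the scalar values taken on \<open>S\<close>.\<close>
    have "vec (polar nrm (star x y) z) = b (m (theta x) (theta y)) (theta z)"
      by (simp flip: b_theta)
    also have "\<dots> = rho (b (theta x) (theta (star y z)))"
      by (subst polar_cyclic1) (simp add: polar_commute)
    also have "\<dots> = vec (polar nrm x (star y z))"
      by (simp only: b_theta rho_vec)
    finally show ?thesis by simp
  qed
qed

lemma vector_grading_Sgr: "vector_grading vector_scalar_mult Sgr"
  unfolding vector_grading_def
proof (intro conjI allI)
  show "vec.subspace (Sgr g)" for g
    by (rule vec.subspaceI) (auto simp: Sgr_def intro: V_add V_vec)
  fix x
  have supp: "{g. theta (c g) \<noteq> 0} = {g. c g \<noteq> 0}" for c :: "'g \<Rightarrow> 'f ^ 8"
    using theta_eq_iff[of _ 0] by simp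
  have theta_sum: "theta (sum c K) = (\<Sum>g\<in>K. theta (c g))" for c :: "'g \<Rightarrow> 'f ^ 8" and K
    by (induction K rule: infinite_finite_induct) auto
  \<comment> \<open>The components of \<open>theta x\<close> stay in \<open>S\<close> by
    \<open>S_proj\<close>, so they can be pulled back.\<close>
  define c where "c = (\<lambda>g. eta (V.proj (theta x) g))"
  have theta_c: "theta (c g) = V.proj (theta x) g" for g
    by (simp add: c_def S_proj theta)
  show "\<exists>!c. (\<forall>g. c g \<in> Sgr g) \<and> finite {g. c g \<noteq> 0} \<and> x = (\<Sum>g | c g \<noteq> 0. c g)"
  proof (rule ex1I[of _ c])
    show "(\<forall>g. c g \<in> Sgr g) \<and> finite {g. c g \<noteq> 0} \<and> x = (\<Sum>g | c g \<noteq> 0. c g)"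
      unfolding supp[of c, symmetric] theta_eq_iff[symmetric, of x] theta_sum
      by (simp add: Sgr_def theta_c V.sum_proj)
  next
    fix d assume d: "(\<forall>g. d g \<in> Sgr g) \<and> finite {g. d g \<noteq> 0} \<and> x = (\<Sum>g | d g \<noteq> 0. d g)"
    then have "V.proj (theta x) = (\<lambda>g. theta (d g))"
      by (intro V.proj_unique[where K = "{g. d g \<noteq> 0}"]) (auto simp: Sgr_def theta_sum)
    then have "theta (c g) = theta (d g)" for g by (simp add: theta_c)
    then show "d = c" by (auto simp: fun_eq_iff)
  qed
qed

lemma algebra_grading_Sgr: "algebra_grading vector_scalar_mult star Sgr"
  unfolding algebra_grading_def
  by (auto intro: vector_grading_Sgr) (simp add: Sgr_def V_m)

text \<open>The inverse of the isomorphism sought. It sends x tensor l to l times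
  \<open>theta x\<close>, written blockwise because tensors are encoded as triples.\<close>

definition Phi :: "'f ^ 8 ^ 3 \<Rightarrow> 'v" where
  "Phi v = (\<Sum>j\<in>UNIV. smul (axis j 1) (theta (v $ j)))"

lemma axis_Phi: "smul (axis j 1) (Phi v) = smul (axis j 1) (theta (v $ j))"
proof -
  have "axis j 1 * axis k 1 = (if k = j then axis j 1 else (0 :: 'f ^ 3))" for k
    by (auto simp: vec_eq_iff axis_def)
  then show ?thesis
    by (simp add: Phi_def scale_sum_right if_distrib[of "\<lambda>a. smul a _"] sum.delta cong: if_cong)
qed

lemma bij_Phi: "bij Phi"
proof (rule bijI)
  show "inj Phi"
  proof (rule injI)
    fix v u assume "Phi v = Phi u"
    then have "smul (axis j 1) (theta (v $ j)) = smul (axis j 1) (theta (u $ j))" for j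
      by (metis axis_Phi)
    then have "theta (v $ j) = theta (u $ j)" for j
      using S_axis_inj theta(1) by metis
    then show "v = u" by (simp add: vec_eq_iff)
  qed
  show "surj Phi"
  proof (rule surjI)
    fix x
    define s where "s j = (SOME s. s \<in> S \<and> smul (axis j 1) x = smul (axis j 1) s)" for j
    have s: "s j \<in> S \<and> smul (axis j 1) x = smul (axis j 1) (s j)" for j
      unfolding s_def by (rule someI_ex) (metis S_axis_surj)
    show "Phi (\<chi> j. eta (SOME s. s \<in> S \<and> smul (axis j 1) x = smul (axis j 1) s)) = x"
      unfolding s_def[symmetric]
      by (rule axis_ext) (simp add: axis_Phi s)
  qed
qed

lemma Phi_add: "Phi (v + u) = Phi v + Phi u"
  by (simp add: Phi_def scale_right_distrib sum.distrib)

lemma Phi_scale: "Phi (tensor_scale (*s) l v) = smul l (Phi v)"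
proof (rule axis_ext)
  fix j
  have "smul (axis j 1) (smul l (Phi v)) = smul l (smul (axis j 1) (theta (v $ j)))"
    by (metis axis_Phi scale_left_commute)
  then show "smul (axis j 1) (Phi (tensor_scale (*s) l v)) = smul (axis j 1) (smul l (Phi v))"
    by (simp add: axis_Phi tensor_scale_def axis_mult mult_axis)
qed

text \<open>As \<open>rho\<close> shifts indices, block i of a product sees only block i + 1 of the
  left factor and block i + 2 of the right one, matching \<open>tensor_mult\<close>.\<close>

lemma axis_m: "smul (axis i 1) (m x y) =
  smul (axis i 1) (m (smul (axis (i + 1) 1) x) (smul (axis (i + 2) 1) y))"
  by (simp add: rho_axis axis_mult)

lemma Phi_m: "Phi (tensor_mult star v u) = m (Phi v) (Phi u)"
proof (rule axis_ext)
  fix j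
  show "smul (axis j 1) (Phi (tensor_mult star v u)) = smul (axis j 1) (m (Phi v) (Phi u))"
    unfolding axis_m[of j "Phi v" "Phi u"] axis_Phi
    by (simp only: tensor_mult_def vec_lambda_beta theta_star axis_m[symmetric])
qed

lemma Phi_Q: "Q (Phi v) = tensor_Q nrm v"
proof -
  have *: "Q x $ j = Q (smul (axis j 1) x) $ j" for x j
    by (simp add: power2_eq_square)
  have "Q (Phi v) $ j = nrm (v $ j)" for j
    by (subst *) (simp add: axis_Phi Q_theta power2_eq_square)
  then show ?thesis by (simp add: tensor_Q_def vec_eq_iff)
qed

lemma Phi_tensor: "Phi (tensor (*s) x l) = smul l (theta x)"
proof (rule axis_ext)
  fix j show "smul (axis j 1) (Phi (tensor (*s) x l)) = smul (axis j 1) (smul l (theta x))"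
    by (simp add: axis_Phi tensor_def axis_mult)
qed

lemma Phi_grading: "Phi ` tensor_grading (*s) Sgr L g = V g"
proof
  let ?T = "restrict_scalars (tensor_scale ((*s) :: 'f \<Rightarrow> 'f ^ 8 \<Rightarrow> 'f ^ 8))"
  interpret T: module ?T by (rule module_tensor_scale) unfold_locales
  have "Phi 0 = 0"
    by (simp add: Phi_def)
  then have "T.subspace (Phi -` V g)"
    by (intro T.subspaceI)
      (auto simp: Phi_add restrict_scalars_def Phi_scale intro: V_add V_vec)
  moreover have "{tensor (*s) x l | x l k. x \<in> Sgr (g - k) \<and> l \<in> L k} \<subseteq> Phi -` V g"
    using V_smul by (fastforce simp: Phi_tensor Sgr_def)
  ultimately show "Phi ` tensor_grading (*s) Sgr L g \<subseteq> V g"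
    unfolding tensor_grading_def using T.span_minimal by blast
  show "V g \<subseteq> Phi ` tensor_grading (*s) Sgr L g"
  proof
    fix x assume "x \<in> V g"
    then obtain s0 s1 s2 where s: "s0 \<in> S" "s0 \<in> V g" "s1 \<in> S" "s1 \<in> V (g - h)" "s2 \<in> S"
      "s2 \<in> V (g - (h + h))" and x: "x = s0 + smul xi s1 + smul (xi * xi) s2"
      using S_split by blast
    \<comment> \<open>The splitting of x read as a tensor, with 1, xi and xi^2 in degrees 0, h and
      2h.\<close>
    define v where "v = tensor (*s) (eta s0) 1 + tensor (*s) (eta s1) xi + tensor (*s) (eta s2) (xi * xi)"
    have "tensor (*s) a l \<in> tensor_grading (*s) Sgr L g" if "a \<in> Sgr (g - k)" "l \<in> L k" for a l k
      using that unfolding tensor_grading_def by (intro T.span_base) auto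
    from this[of "eta s0" 0 1] this[of "eta s1" h xi] this[of "eta s2" "h + h" "xi * xi"]
    have "v \<in> tensor_grading (*s) Sgr L g"
      unfolding v_def tensor_grading_def
      using s xi_in_L xi_xi_in_L vec_in_L[of 1]
      by (intro T.span_add) (auto simp: Sgr_def)
    moreover have "Phi v = x" using s by (simp add: v_def Phi_add Phi_tensor x)
    ultimately show "x \<in> Phi ` tensor_grading (*s) Sgr L g" by blast
  qed
qed

lemma graded_isomorphic_tensor:
  "graded_isomorphic smul m Q V L (tensor_scale (*s)) (tensor_mult star) (tensor_Q nrm)
     (tensor_grading (*s) Sgr L) L"
  unfolding graded_isomorphic_def
proof (intro exI[of _ "inv Phi"] exI[of _ id] conjI allI)
  have inv: "inv Phi y = v \<longleftrightarrow> y = Phi v" for y v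
    by (metis bij_Phi bij_inv_eq_iff)
  have Phi_inv: "Phi (inv Phi x) = x" for x by (metis inv)
  show "inv Phi ` V g = tensor_grading (*s) Sgr L g" for g
    by (metis Phi_grading bij_Phi bij_is_inj image_inv_f_f)
  have hom_id: "module_hom (*s) (*s) (id :: 'f ^ 3 \<Rightarrow> 'f ^ 3)"
    by (intro module_hom.intro module_hom_axioms.intro vec.module_axioms) simp_all
  show "cyclic_composition_iso smul m Q (tensor_scale (*s)) (tensor_mult star) (tensor_Q nrm)
      (inv Phi) id"
    unfolding cyclic_composition_iso_def
    by (auto simp: bij_imp_bij_inv bij_Phi inv Phi_inv Phi_add Phi_scale Phi_m hom_id
        simp flip: Phi_Q)
qed simp

end

section \<open>Para-units\<close>

context symmetric_composition_algebra
begin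

lemma polar_same: "polar n x x = 2 * n x"
proof -
  have "x + x = smul 2 x"
    by (metis one_add_one scale_left_distrib scale_one)
  then show ?thesis
    using quadratic by (simp add: polar_def quadratic_form_def)
qed

text \<open>Kaplansky's trick: multiplying conjugates turns the para-unit u into a unit, and since
  conjugation is a norm-preserving involution, conjugating again recovers
  \<open>star\<close>.\<close>

lemma para_cayley_if_para_unit:
  assumes dim: "dim UNIV = 8" and u: "n u = 1"
    and "\<And>x. star u x = smul (polar n x u) u - x" "\<And>x. star x u = smul (polar n x u) u - x"
  shows "para_cayley_algebra smul star n"
proof -
  define bar where "bar = standard_involution smul u n"
  have bar: "bar x = star u x" "star x u = bar x" for x
    using assms by (simp_all add: bar_def standard_involution_def)
  interpret star_u: module_hom smul smul "star u"
    using bilinear_star by (simp add: bilinear_over_def)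
  interpret polar_u: module_hom smul "(*)" "\<lambda>x. polar n x u"
    using quadratic by (simp add: quadratic_form_def bilinear_over_def)
  have "module_hom smul smul (\<lambda>x. star x z)" "module_hom smul smul (star z)" for z
    using bilinear_star by (simp_all add: bilinear_over_def)
  note star_lin = this[THEN module_hom.add] this[THEN module_hom.scale]
  have "smul 2 u = u + u"
    by (metis one_add_one scale_left_distrib scale_one)
  then have bar_u: "bar u = u"
    using u by (simp add: bar_def standard_involution_def polar_same)
  have bar_bar: "bar (bar x) = x" for x
  proof -
    have "polar n (bar x) u = polar n x u"
      by (simp add: bar_def standard_involution_def polar_u.diff polar_u.scale polar_same u)
    then show ?thesis by (simp add: bar_def standard_involution_def)
  qed
  have n_bar: "n (bar x) = n x" for x
    by (simp add: bar n_star u)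
  have "cayley_algebra smul (\<lambda>x y. star (bar x) (bar y)) u n"
  proof
    show "bilinear_over smul smul smul (\<lambda>x y. star (bar x) (bar y))"
      by (rule bilinear_overI) (simp_all add: module_axioms bar star_lin)
    show "star (bar u) (bar x) = x" "star (bar x) (bar u) = x" for x
      by (metis bar bar_bar bar_u)+
  qed (simp_all add: dim quadratic nonsing n_star n_bar)
  then show ?thesis
    unfolding para_cayley_algebra_def
    by (intro exI[of _ "\<lambda>x y. star (bar x) (bar y)"] exI[of _ u]) (simp add: bar_bar flip: bar_def)
qed

end

lemma para_cayley_para_unit:
  fixes smul :: "'f::field \<Rightarrow> 's::ab_group_add \<Rightarrow> 's"
  assumes "para_cayley_algebra smul star n"
  obtains u where "n u = 1" "\<And>x. star u x = smul (polar n x u) u - x"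
    "\<And>x. star x u = smul (polar n x u) u - x"
proof -
  obtain m u where "cayley_algebra smul m u n"
    and star: "\<And>x y. star x y = m (standard_involution smul u n x) (standard_involution smul u n y)"
    using assms by (auto simp: para_cayley_algebra_def)
  interpret cayley_algebra smul m u n by fact
  have "n u = 1"
  proof (rule ccontr)
    assume "n u \<noteq> 1"
    \<comment> \<open>The norm of the unit is idempotent. If it were 0, then n would vanish
      identically and nonsingularity would force the zero space.\<close>
    then have "n u = 0" using n_m[of u u] by (simp add: unit_left)
    then have "n x = 0" for x using n_m[of u x] by (simp add: unit_left)
    then have "x = 0" for x :: 's using nonsing by (simp add: nonsingular_def polar_def)
    then have "UNIV = {0 :: 's}" by blast
    then have "span {} = span UNIV" by (simp only: span_empty span_UNIV)
    then have "dim UNIV = card ({} :: 's set)"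
      by (intro dim_eq_card independent_empty)
    then show False using dim_8 by simp
  qed
  moreover have "standard_involution smul u n u = u"
  proof -
    have "u + u = smul 2 u"
      by (metis one_add_one scale_left_distrib scale_one)
    then have "polar n u u = 2"
      using quadratic \<open>n u = 1\<close> by (simp add: polar_def quadratic_form_def)
    then show ?thesis
      by (metis add_diff_cancel_left' one_add_one scale_left_distrib scale_one standard_involution_def)
  qed
  ultimately show ?thesis
    using that[of u] star unit_left unit_right by (metis standard_involution_def)
qed

section \<open>Complementing a subgroup of order three in the 3-torsion\<close>

lemma exists_complement_of_order_3:
  fixes h :: "'g::ab_group_add"
  assumes "h \<noteq> 0" "h + h + h = 0"
  obtains K where "0 \<in> K" "\<And>x y. x \<in> K \<Longrightarrow> y \<in> K \<Longrightarrow> x + y \<in> K" "h \<notin> K" "h + h \<notin> K"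
    "\<And>g. g + g + g = 0 \<Longrightarrow> g \<in> K \<or> g - h \<in> K \<or> g - (h + h) \<in> K"
proof -
  define A where "A = {K :: 'g set. 0 \<in> K \<and> (\<forall>x\<in>K. \<forall>y\<in>K. x + y \<in> K) \<and> (\<forall>x\<in>K. - x \<in> K) \<and> h \<notin> K}"
  have "{0} \<in> A" using assms by (auto simp: A_def)
  then have "A \<noteq> {}" by auto
  moreover have "\<Union>C \<in> A" if "C \<noteq> {}" "subset.chain A C" for C
  proof -
    have C: "C \<subseteq> A" and lin: "\<And>X Y. X \<in> C \<Longrightarrow> Y \<in> C \<Longrightarrow> X \<subseteq> Y \<or> Y \<subseteq> X"
      using that(2) by (auto simp: subset_chain_def)
    have "x + y \<in> \<Union>C" if xy: "x \<in> \<Union>C" "y \<in> \<Union>C" for x y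
    proof -
      obtain X Y where XY: "X \<in> C" "Y \<in> C" "x \<in> X" "y \<in> Y" using xy by blast
      then obtain Z where "Z \<in> C" "x \<in> Z" "y \<in> Z" using lin[of X Y] by blast
      moreover from this have "x + y \<in> Z" using C unfolding A_def by blast
      ultimately show ?thesis by blast
    qed
    moreover have "- x \<in> \<Union>C" if "x \<in> \<Union>C" for x
      using that C unfolding A_def by blast
    moreover have "0 \<in> \<Union>C" using that(1) C unfolding A_def by blast
    moreover have "h \<notin> \<Union>C" using C unfolding A_def by blast
    ultimately show ?thesis by (simp only: A_def mem_Collect_eq) blast
  qed
  ultimately obtain K where K: "K \<in> A" and max: "\<And>X. X \<in> A \<Longrightarrow> K \<subseteq> X \<Longrightarrow> X = K"
    using subset_Zorn_nonempty[of A] by blast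
  have K0: "0 \<in> K" and add: "\<And>x y. x \<in> K \<Longrightarrow> y \<in> K \<Longrightarrow> x + y \<in> K"
    and minus: "\<And>x. x \<in> K \<Longrightarrow> - x \<in> K" and hK: "h \<notin> K"
    using K by (auto simp: A_def)
  have h2: "- (h + h) = h"
    using assms(2) by (simp add: add.assoc minus_unique)
  have "g \<in> K \<or> g - h \<in> K \<or> g - (h + h) \<in> K" if g: "g + g + g = 0" for g
  proof (rule ccontr)
    assume not: "\<not> ?thesis"
    \<comment> \<open>As 3g = 0, this is the subgroup generated by K and g. It avoids h because no
      listed translate of g lies in K, which contradicts maximality.\<close>
    define X where "X = {k + i | k i. k \<in> K \<and> (i = 0 \<or> i = g \<or> i = g + g)}"
    have inX: "k + i \<in> X" if "k \<in> K" "i = 0 \<or> i = g \<or> i = g + g" for k i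
      using that by (auto simp: X_def)
    have "K \<subseteq> X" using inX[of _ 0] by auto
    moreover have "g \<in> X" using inX[of 0 g] K0 by simp
    moreover have "X \<in> A"
    proof -
      have g4: "g + g + (g + g) = g" "- g = g + g" "- (g + g) = g"
        using g by (simp_all add: add.assoc minus_unique)
      have "x + y \<in> X" if xy: "x \<in> X" "y \<in> X" for x y
      proof -
        obtain k i k' i' where "x = k + i" "y = k' + i'" "k \<in> K" "k' \<in> K"
          "i = 0 \<or> i = g \<or> i = g + g" "i' = 0 \<or> i' = g \<or> i' = g + g"
          using xy unfolding X_def by blast
        moreover from this have "i + i' = 0 \<or> i + i' = g \<or> i + i' = g + g"
          using g g4 by (auto simp: add.assoc)
        ultimately show ?thesis using inX[of "k + k'" "i + i'"] add
          by (metis (no_types, lifting) add.assoc add.left_commute)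
      qed
      moreover have "- x \<in> X" if xX: "x \<in> X" for x
      proof -
        obtain k i where x: "x = k + i" "k \<in> K" "i = 0 \<or> i = g \<or> i = g + g"
          using xX unfolding X_def by blast
        moreover from this have "- i = 0 \<or> - i = g \<or> - i = g + g"
          using g4 by auto
        ultimately show ?thesis using inX[of "- k" "- i"] minus by simp
      qed
      moreover have "h \<notin> X"
      proof
        assume "h \<in> X"
        then obtain k i where k: "h = k + i" "k \<in> K" "i = 0 \<or> i = g \<or> i = g + g"
          by (auto simp: X_def)
        from k(3) show False
        proof (elim disjE)
          assume "i = 0" then show False using k hK by simp
        next
          assume "i = g" then have "g - h = - k" using k by simp
          then show False using minus[OF k(2)] not by simp
        next
          \<comment> \<open>From h = k + 2g and 3g = 3h = 0 follows k = h + g = g - 2h.\<close>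
          assume "i = g + g"
          then have "g - (h + h) = k" using k(1) g h2 g4
            by (metis add.commute add_diff_cancel_left' diff_conv_add_uminus minus_add_distrib minus_minus)
          then show False using k(2) not by simp
        qed
      qed
      ultimately show ?thesis using inX[of 0 0] K0 by (simp add: A_def)
    qed
    ultimately have "g \<in> K" using max by blast
    then show False using not by blast
  qed
  moreover have "h + h \<notin> K" using minus[of "h + h"] h2 hK by metis
  ultimately show ?thesis using that K0 add hK by blast
qed

text \<open>These equations make a x + c (x*x) idempotent when Q(x) = 1 and b(x*x, x) = t.\<close>

lemma idempotent_equations:
  fixes t :: "'f::alg_closed_field"
  assumes "(2::'f) \<noteq> 0" "(3::'f) \<noteq> 0"
  obtains a c where "c \<noteq> 0" "a = 2 * a * c + c\<^sup>2 * t" "c = a\<^sup>2 - c\<^sup>2"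
proof (cases "t = 0")
  case True
  then show ?thesis using that[of "- 1" 0] by simp
next
  case False
  \<comment> \<open>Eliminating a from a(1 - 2c) = c^2 t and a^2 = c(1 + c), and dividing by c,
    leaves this polynomial. Its linear coefficient -3 keeps it nonconstant even when t^2 =
    4.\<close>
  have "degree [:1, - 3, 0, 4 - t\<^sup>2:] > 0" using assms by simp
  then obtain c where "poly [:1, - 3, 0, 4 - t\<^sup>2:] c = 0"
    using alg_closed_imp_poly_has_root by blast
  then have c: "(1 + c) * (1 - 2 * c)\<^sup>2 = c ^ 3 * t\<^sup>2"
    by (simp add: algebra_simps power2_eq_square power3_eq_cube)
  then have c0: "c \<noteq> 0" by auto
  then have c2: "1 - 2 * c \<noteq> 0" using c False by auto
  define a where "a = c\<^sup>2 * t / (1 - 2 * c)"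
  have a: "a * (1 - 2 * c) = c\<^sup>2 * t" using c2 by (simp add: a_def)
  then have "a\<^sup>2 * (1 - 2 * c)\<^sup>2 = c * (c ^ 3 * t\<^sup>2)"
    by (simp add: power_mult_distrib flip: power_mult_distrib) (simp add: power_mult_distrib power2_eq_square power3_eq_cube)
  also have "\<dots> = (c * (1 + c)) * (1 - 2 * c)\<^sup>2"
    unfolding c[symmetric] by (simp add: mult.assoc)
  finally have "a\<^sup>2 = c * (1 + c)" using c2 by simp
  then show ?thesis
    using that[of c a] c0 a by (simp add: algebra_simps power2_eq_square)
qed

section \<open>Existence of forms\<close>

context type_III_algebra
begin

lemma xi_smul [simp]: "smul xi (smul (xi * xi) x) = x" "smul (xi * xi) (smul xi x) = x"
  using xi_cubed by (simp_all add: mult.assoc)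

lemma xi_V: "x \<in> V g \<Longrightarrow> smul xi x \<in> V (g - (h + h))"
  and xi_xi_V: "x \<in> V g \<Longrightarrow> smul (xi * xi) x \<in> V (g - h)"
proof -
  have "h + g = g - (h + h)" "h + h + g = g - h"
    using h_sums(3,4) by (metis add.commute diff_conv_add_uminus)+
  then show "x \<in> V g \<Longrightarrow> smul xi x \<in> V (g - (h + h))"
    "x \<in> V g \<Longrightarrow> smul (xi * xi) x \<in> V (g - h)"
    using V_smul[OF xi_in_L, of x g] V_smul[OF xi_xi_in_L, of x g] by (simp_all only:)
qed

lemma smul_vec_eq_0: "smul (vec a) x = 0 \<longleftrightarrow> a = 0 \<or> x = 0"
  using F.scale_eq_0_iff[of a x] by (simp add: restrict_scalars_def)

text \<open>Two vectors of degree 0 pair to 1, so Q cannot vanish on both of them and on their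
  sum.\<close>

lemma anisotropic_in_V_0:
  assumes "V 0 \<noteq> {0}" obtains x where "x \<in> V 0" "Q x \<noteq> 0"
proof -
  obtain x where x: "x \<in> V 0" "x \<noteq> 0" using assms V.zero_A by blast
  obtain y where y: "y \<in> V 0" "b x y = 1"
    using homogeneous_pairing[OF x] by auto
  have "Q (x + y) - Q x - Q y \<noteq> 0" using y(2) by (simp add: polar_def)
  then have "Q (x + y) \<noteq> 0 \<or> Q x \<noteq> 0 \<or> Q y \<noteq> 0" by auto
  then show ?thesis using that x y V_add by blast
qed

lemma Q_V_0: "x \<in> V 0 \<Longrightarrow> \<exists>a. Q x = vec a"
  using Q_homogeneous[of x 0] L_0 by auto

text \<open>Here Q(e) is a scalar by degree, and e = (e*e)*e = rho^2(Q e) e.\<close>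

lemma idempotent_Q_eq_1:
  assumes "e \<in> V 0" "m e e = e" "e \<noteq> 0" shows "Q e = 1"
proof -
  obtain a where a: "Q e = vec a" using Q_V_0 assms by blast
  moreover have "vec (1 - a) = (1 - vec a :: 'f ^ 3)"
    by (simp add: vec_eq_iff)
  ultimately have "smul (vec (1 - a)) e = 0"
    using m_m_same_left[of e e] assms(2) by (simp add: scale_left_diff_distrib)
  then show ?thesis using assms(3) a by (simp add: smul_vec_eq_0)
qed

section \<open>The case V_0 = 0\<close>

context
  assumes V_0: "V 0 = {0}"
begin

lemma isotropic: assumes "x \<in> V g" "x \<noteq> 0"
  shows "Q x = 0" "m x x \<noteq> 0" "g + g + g = 0"
proof -
  have nonzero: "Q x = 0 \<and> m x x \<noteq> 0" if x: "x \<in> V g" "x \<noteq> 0" for x g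
  proof -
    obtain y where y: "y \<in> V (- g)" "b x y = 1"
      using homogeneous_pairing[OF x] by blast
    have xy: "m x y = 0" "m y x = 0"
      using V_m[OF x(1) y(1)] V_m[OF y(1) x(1)] V_0 by simp_all
    have "Q x = 0"
    proof (rule ccontr)
      assume "Q x \<noteq> 0"
      then obtain l where l: "l * Q x = 1"
        using L_unit[OF Q_homogeneous[OF x(1)]] by blast
      \<comment> \<open>The unit Q(x) stays a unit under rho^2, so (x*y)*x = rho^2(Q x) y = 0 would
        force y = 0.\<close>
      have "rho (rho (l * Q x)) = 1" by (simp only: l rho_1)
      then have "rho (rho l) * rho (rho (Q x)) = 1" by simp
      moreover have "smul (rho (rho l)) (smul (rho (rho (Q x))) y) = 0"
        using m_m_same_left[of x y] xy by simp
      ultimately have "y = 0" by simp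
      then show False using y(2) by simp
    qed
    moreover have "m (m x x) y = x"
      using m_m_left[of x x y] xy y by simp
    ultimately show ?thesis using x(2) by auto
  qed
  show "Q x = 0" "m x x \<noteq> 0" using nonzero assms by auto
  moreover have "m (m x x) (m x x) \<noteq> 0"
    using nonzero[of "m x x" "g + g"] V_m[OF assms(1,1)] \<open>m x x \<noteq> 0\<close> by blast
  \<comment> \<open>With Q(x) = 0, \<open>m_square_square\<close> reads (x*x)*(x*x) = b(x*x, x)
    x.\<close>
  ultimately have T: "b (m x x) x \<noteq> 0"
    using m_square_square[of x] by auto
  moreover have "b (m x x) x \<in> L (g + g + g)"
    using assms V_m L_b by blast
  moreover have "b (m x x) x \<in> L 0"
    using rho_fixed_imp_vec[OF rho_cubic] vec_in_L by metis
  ultimately show "g + g + g = 0"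
    using L.disjoint_degrees by blast
qed

lemma exists_complement_form:
  obtains S where "F.subspace S" "\<And>x y. x \<in> S \<Longrightarrow> y \<in> S \<Longrightarrow> m x y \<in> S"
    "\<And>x. x \<in> S \<Longrightarrow> \<exists>a. Q x = vec a"
    "\<And>x g. x \<in> V g \<Longrightarrow> \<exists>s0 s1 s2. s0 \<in> S \<inter> V g \<and> s1 \<in> S \<inter> V (g - h) \<and>
          s2 \<in> S \<inter> V (g - (h + h)) \<and> x = s0 + smul xi s1 + smul (xi * xi) s2"
proof -
  obtain K where K: "0 \<in> K" "\<And>x y. x \<in> K \<Longrightarrow> y \<in> K \<Longrightarrow> x + y \<in> K" "h \<notin> K" "h + h \<notin> K"
    "\<And>g. g + g + g = 0 \<Longrightarrow> g \<in> K \<or> g - h \<in> K \<or> g - (h + h) \<in> K"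
    using exists_complement_of_order_3[OF h_neq_0 h_thrice] by blast
  \<comment> \<open>The sum of all components with degree in K, expressed by vanishing
    projections.\<close>
  define S where "S = {x. \<forall>g. g \<notin> K \<longrightarrow> V.proj x g = 0}"
  have sub: "F.subspace S"
    by (rule F.subspaceI) (auto simp: S_def V.proj_add V.proj_scale)
  have V_S: "x \<in> S" if "x \<in> V k" "k \<in> K" for x k
    using that by (auto simp: S_def V.proj_homogeneous)
  have S_sum: "\<exists>G. G \<subseteq> K \<and> x = (\<Sum>g\<in>G. V.proj x g)" if "x \<in> S" for x
    using that by (intro exI[of _ "{g. V.proj x g \<noteq> 0}"]) (auto simp: S_def V.sum_proj)
  have S_m: "m x y \<in> S" if x: "x \<in> S" and y: "y \<in> S" for x y
  proof -
    obtain G H where G: "G \<subseteq> K" "x = (\<Sum>g\<in>G. V.proj x g)" and H: "H \<subseteq> K" "y = (\<Sum>g\<in>H. V.proj y g)"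
      using S_sum[OF x] S_sum[OF y] by blast
    have "m x y = (\<Sum>k\<in>H. \<Sum>g\<in>G. m (V.proj x g) (V.proj y k))"
      by (subst G(2), subst H(2)) (simp add: m_sum_left m_sum_right)
    also have "\<dots> \<in> S"
    proof (intro F.subspace_sum[OF sub])
      fix k g assume "k \<in> H" "g \<in> G"
      then show "m (V.proj x g) (V.proj y k) \<in> S"
        using G(1) H(1) K(2) by (intro V_S[OF V_m[OF V.proj_in V.proj_in]]) blast
    qed
    finally show ?thesis .
  qed
  have S_Q: "\<exists>a. Q x = vec a" if x: "x \<in> S" for x
  proof -
    obtain G where G: "G \<subseteq> K" "x = (\<Sum>g\<in>G. V.proj x g)"
      using S_sum[OF x] by blast
    have "b x x = (\<Sum>k\<in>G. \<Sum>g\<in>G. b (V.proj x g) (V.proj x k))"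
      by (subst (1 2) G(2), subst b_sum_right) (simp only: b_sum_left)
    also have "\<dots> \<in> L 0"
    proof (intro vec.subspace_sum[OF L.subspace_A])
      fix k g assume "k \<in> G" "g \<in> G"
      \<comment> \<open>The degree g + k lies in K, which contains neither h nor 2h, so a nonzero
        value of b must have degree 0.\<close>
      then have gk: "g + k \<in> K" using G(1) K(2) by blast
      have in_L: "b (V.proj x g) (V.proj x k) \<in> L (g + k)"
        by (intro L_b V.proj_in)
      show "b (V.proj x g) (V.proj x k) \<in> L 0"
      proof (cases "b (V.proj x g) (V.proj x k) = 0")
        case False
        then have "g + k = 0" using L_degrees[OF in_L] gk K(3,4) by auto
        then show ?thesis using in_L by simp
      qed simp
    qed
    finally have "(1 / 2) *s b x x \<in> L 0"
      by (rule vec.subspace_scale[OF L.subspace_A])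
    moreover have "Q x = (1 / 2) *s b x x"
      using two by (simp add: b_same vec_eq_iff)
    ultimately show ?thesis using L_0 by auto
  qed
  have "\<exists>s0 s1 s2. s0 \<in> S \<inter> V g \<and> s1 \<in> S \<inter> V (g - h) \<and>
          s2 \<in> S \<inter> V (g - (h + h)) \<and> x = s0 + smul xi s1 + smul (xi * xi) s2"
    if x: "x \<in> V g" for x g
  proof (cases "x = 0")
    case True
    then show ?thesis using F.subspace_0[OF sub] by (intro exI[of _ 0]) simp
  next
    case False
    have 0: "0 \<in> S" using F.subspace_0[OF sub] .
    \<comment> \<open>One of x, xi^2 x and xi x has degree in K, so a single summand
      suffices.\<close>
    from K(5)[OF isotropic(3)[OF x False]] show ?thesis
    proof (elim disjE)
      assume "g \<in> K"
      then show ?thesis using x V_S 0 by (intro exI[of _ x] exI[of _ 0]) simp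
    next
      assume "g - h \<in> K"
      then show ?thesis using xi_xi_V[OF x] V_S 0
        by (intro exI[of _ 0] exI[of _ "smul (xi * xi) x"] exI[of _ 0]) (simp add: xi_smul del: scale_scale)
    next
      assume "g - (h + h) \<in> K"
      then show ?thesis using xi_V[OF x] V_S 0
        by (intro exI[of _ 0] exI[of _ 0] exI[of _ "smul xi x"]) (simp add: xi_smul del: scale_scale)
    qed
  qed
  with sub S_m S_Q show ?thesis by (rule that)
qed

end
end

section \<open>The case of an idempotent of degree 0\<close>

locale type_III_idempotent = type_III_algebra smul m Q V L w h xi +
  cyclic_composition_idempotent smul m Q e
  for smul :: "('f::field) ^ 3 \<Rightarrow> 'v::ab_group_add \<Rightarrow> 'v" and m Q
    and V :: "'g::ab_group_add \<Rightarrow> 'v set" and L w h xi e +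
  assumes e_V_0: "e \<in> V 0"
begin

lemma V_aut: "x \<in> V g \<Longrightarrow> aut x \<in> V g"
  using V_m[OF e_V_0 V_m[OF e_V_0]] by (simp add: aut_def)

lemma subspace_fixed: "F.subspace {x. aut x = x}"
  by (rule F.subspaceI) (simp_all add: restrict_scalars_def)

text \<open>x splits into eigenvectors of \<open>aut\<close> for 1, w and w^2. Since
  \<open>aut\<close> is \<open>rho\<close>-semilinear and rho(xi) = w xi, multiplying the second by
  xi^2 and the third by xi makes them fixed.\<close>

lemma fixed_split:
  assumes x: "x \<in> V g"
  shows "\<exists>s0 s1 s2. s0 \<in> {x. aut x = x} \<inter> V g \<and> s1 \<in> {x. aut x = x} \<inter> V (g - h) \<and>
          s2 \<in> {x. aut x = x} \<inter> V (g - (h + h)) \<and> x = s0 + smul xi s1 + smul (xi * xi) s2"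
proof -
  have w3: "w * (w * w) = 1" using w_cubed by (simp add: power3_eq_cube mult.assoc)
  then have w3': "vec w * (vec w * vec w) = (1 :: 'f ^ 3)"
    by (simp flip: vec_mult)
  define c where "c = (1 / 3 :: 'f)"
  have c3: "c + c + c = 1"
  proof -
    have "c + c + c = 3 * c" by simp
    then show ?thesis using three by (simp add: c_def)
  qed
  \<comment> \<open>For (a, d) = (1, 1), (w^2, w) and (w, w^2) these averages project onto the
    eigenspaces for 1, w and w^2.\<close>
  define p where "p a d = smul (vec c) (x + (smul (vec a) (aut x) + smul (vec d) (aut (aut x))))" for a d
  have p_V: "p a d \<in> V g" for a d
    unfolding p_def by (intro V_vec V_add V_aut x)
  have aut_p: "aut (p a d) = smul (vec q) (p a d)" if "q * a = 1" "a = q * d" "d = q" for a d q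
  proof -
    have "aut (p a d) = smul (vec c) (aut x + (smul (vec a) (aut (aut x)) + smul (vec d) x))"
      by (simp add: p_def)
    moreover have "smul (vec q) (p a d) =
      smul (vec c) (smul (vec q) x + (smul (vec (q * a)) (aut x) + smul (vec (q * d)) (aut (aut x))))"
      by (simp add: p_def scale_right_distrib vec_mult mult_ac)
    ultimately show ?thesis
      using that by (simp add: add_ac)
  qed
  define s0 s1 s2 where "s0 = p 1 1" and "s1 = smul (xi * xi) (p (w * w) w)" and "s2 = smul xi (p w (w * w))"
  have "aut s0 = s0"
    using aut_p[of 1 1 1] by (simp add: s0_def)
  moreover have "aut s1 = s1"
    using aut_p[of w "w * w" w] w3 w3' by (simp add: s1_def vec_mult mult_ac)
  moreover have "aut s2 = s2"
    using aut_p[of "w * w" w "w * w"] w3 w3' by (simp add: s2_def vec_mult mult_ac)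
  moreover have "s0 \<in> V g" "s1 \<in> V (g - h)" "s2 \<in> V (g - (h + h))"
    using p_V xi_V xi_xi_V by (auto simp: s0_def s1_def s2_def)
  moreover have "x = s0 + smul xi s1 + smul (xi * xi) s2"
  proof -
    have "c + c * w + c * (w * w) = c * (1 + w + w\<^sup>2)"
      by (simp add: algebra_simps power2_eq_square)
    also have "\<dots> = 0" by (simp only: w_sum mult_zero_right)
    finally have w1: "c + c * w + c * (w * w) = 0" "c + c * (w * w) + c * w = 0"
      by (simp_all only: add_ac)
    have "s0 + smul xi s1 + smul (xi * xi) s2 = p 1 1 + p (w * w) w + p w (w * w)"
      unfolding s0_def s1_def s2_def by (simp only: xi_smul)
    also have "\<dots> = (smul (vec c) x + smul (vec c) x + smul (vec c) x)
      + (smul (vec c) (aut x) + smul (vec (c * (w * w))) (aut x) + smul (vec (c * w)) (aut x))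
      + (smul (vec c) (aut (aut x)) + smul (vec (c * w)) (aut (aut x)) + smul (vec (c * (w * w))) (aut (aut x)))"
      by (simp add: p_def vec_mult scale_right_distrib add_ac)
    also have "\<dots> = x"
      unfolding scale_left_distrib[symmetric] vec_plus[symmetric] c3 w1 by simp
    finally show ?thesis by simp
  qed
  ultimately show ?thesis by blast
qed

end

text \<open>The locale lives over a general field, so the two consequences of algebraic closure
  needed here enter as \<open>equations\<close> and \<open>roots\<close>.\<close>

lemma (in type_III_algebra) exists_idempotent:
  assumes "V 0 \<noteq> {0}"
    and equations: "\<And>t :: 'f. \<exists>a c. c \<noteq> 0 \<and> a = 2 * a * c + c\<^sup>2 * t \<and> c = a\<^sup>2 - c\<^sup>2"
    and roots: "\<And>t :: 'f. \<exists>r. r\<^sup>2 = t"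
  obtains e where "e \<in> V 0" "m e e = e" "Q e = 1"
proof -
  obtain y where y: "y \<in> V 0" "Q y \<noteq> 0"
    using anisotropic_in_V_0 assms(1) by blast
  obtain q where q: "Q y = vec q" using Q_V_0 y by blast
  obtain r where r: "r\<^sup>2 = q" using roots by blast
  define x where "x = smul (vec (1 / r)) y"
  have "q \<noteq> 0" using y q by auto
  then have "r \<noteq> 0" using r by auto
  have "Q x = vec ((1 / r)\<^sup>2 * q)"
    by (simp only: x_def q Q_smul vec_mult power2_eq_square)
  then have Qx: "Q x = 1"
    using \<open>r \<noteq> 0\<close> by (simp add: power_divide r[symmetric])
  have x: "x \<in> V 0" using y V_vec by (simp add: x_def)
  have xx: "m x x \<in> V 0" using V_m[OF x x] by simp
  obtain t where t: "b (m x x) x = vec t"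
    using rho_fixed_imp_vec[OF rho_cubic] by metis
  obtain a c where c: "c \<noteq> 0" and a: "a = 2 * a * c + c\<^sup>2 * t" and ca: "c = a\<^sup>2 - c\<^sup>2"
    using equations by blast
  have xxx: "m (m x x) x = x" "m x (m x x) = x"
    using m_m_same_left[of x x] m_m_same_right[of x x] Qx by simp_all
  have xxxx: "m (m x x) (m x x) = smul (vec t) x - m x x"
    using m_square_square[of x] t Qx by simp
  define e where "e = smul (vec a) x + smul (vec c) (m x x)"
  have e: "e \<in> V 0" unfolding e_def by (intro V_add V_vec x xx)
  have "m e e = smul (vec (a * c)) x + smul (vec (a * c)) x + smul (vec (c * c * t)) x
      + (smul (vec (a * a)) (m x x) - smul (vec (c * c)) (m x x))"
    by (simp add: e_def xxx xxxx vec_mult algebra_simps)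
  also have "\<dots> = smul (vec (a * c + a * c + c * c * t)) x + smul (vec (a * a - c * c)) (m x x)"
    by (simp only: vec_plus vec_sub scale_left_distrib scale_left_diff_distrib)
  finally have "m e e = \<dots>" .
  moreover have "a * c + a * c + c * c * t = a" "a * a - c * c = c"
    using a ca by (metis mult.assoc mult_2 power2_eq_square)+
  ultimately have ee: "m e e = e" by (simp only: e_def)
  show ?thesis
  proof (cases "e = 0")
    case False
    then show ?thesis using that[of e] e ee idempotent_Q_eq_1 by blast
  next
    case True
    \<comment> \<open>If the combination vanishes, then x*x = k x. Comparing values of Q gives k^2 =
      1, and x*x is itself an idempotent.\<close>
    define k where "k = - a / c"
    have "smul (vec (1 / c)) e = 0" using True by simp
    then have "smul (vec (a / c)) x + m x x = 0"
      using c by (simp add: e_def scale_right_distrib flip: vec_mult)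
    then have kx: "m x x = smul (vec k) x"
      by (simp add: k_def eq_neg_iff_add_eq_0 add.commute vec_neg)
    have "m (m x x) (m x x) = smul (vec (k * k)) (m x x)"
      by (subst (1 2) kx) (simp add: vec_mult)
    moreover have "vec (k * k) = (1 :: 'f ^ 3)"
      using Q_m[of x x] kx Qx by (simp add: power2_eq_square vec_mult)
    ultimately have idem: "m (m x x) (m x x) = m x x" by simp
    have "m x x \<noteq> 0" using xxx(1) x Qx by force
    then show ?thesis using that[of "m x x"] idem xx idempotent_Q_eq_1 by blast
  qed
qed

section \<open>Identification of the forms\<close>

context descent
begin

sublocale Sgr: graded_space vector_scalar_mult Sgr
  by unfold_locales (rule vector_grading_Sgr)

text \<open>Put the para-unit formulas into (u*x)*x + (x*x)*u = b(u, x) x. For isotropic x,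
  cyclicity gives b(x*x, u) = b(x, u)^2; then divide by 2.\<close>

lemma star_star_para_unit:
  assumes u: "\<And>x. star u x = polar nrm x u *s u - x" "\<And>x. star x u = polar nrm x u *s u - x"
    and x: "nrm x = 0"
  shows "star x x = polar nrm x u *s (polar nrm x u *s u - x)"
proof -
  let ?t = "polar nrm x u"
  have commute: "polar nrm u x = ?t"
    by (simp add: polar_def add.commute)
  have "m (theta (star u x)) (theta x) + theta (star (star x x) u) = smul (rho (rho (b (theta u) (theta x)))) (theta x)"
    using m_m_left[of "theta u" "theta x" "theta x"] by simp
  then have "theta (star (star u x) x + star (star x x) u) = theta (?t *s x)"
    by (simp add: b_theta commute)
  then have 1: "star (star u x) x + star (star x x) u = ?t *s x" by (simp only: theta_eq_iff)
  have star_lin: "star (c *s y - z) x = c *s star y x - star z x" for c y z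
    by (simp flip: theta_eq_iff)
  have "vec (polar nrm (star x x) u) = rho (b (theta (star x u)) (theta x))"
    unfolding b_theta[symmetric] theta_star by (rule polar_cyclic1)
  also have "\<dots> = vec (?t * ?t)"
    by (simp only: u(2) theta_diff theta_scale b_diff_left b_smul_left b_theta commute)
      (simp add: vec_mult star.polar_same x)
  finally have 2: "polar nrm (star x x) u = ?t * ?t" by simp
  have "(?t *s (?t *s u - x) - star x x) + ((?t * ?t) *s u - star x x) = ?t *s x"
    using 1 by (simp only: u star_lin 2)
  then have "2 *s star x x = 2 *s (?t *s (?t *s u - x))"
    by (simp add: vec_eq_iff algebra_simps)
  then show ?thesis using two by (simp only: vec.scale_cancel_left) simp
qed

lemma no_para_unit:
  assumes V_0: "V 0 = {0}" and n_u: "nrm u = 1"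
    and u: "\<And>x. star u x = polar nrm x u *s u - x" "\<And>x. star x u = polar nrm x u *s u - x"
  shows False
proof -
  have S_0: "x = 0" if "x \<in> Sgr 0" for x
    using that V_0 theta_eq_iff[of x 0] by (simp add: Sgr_def)
  define U where "U = Sgr.proj u"
  \<comment> \<open>Compare degree k in x*u = b(x, u) u - x: the left side has no such component,
    because u has none in degree 0.\<close>
  have homogeneous: "x = polar nrm x u *s U k" if x: "x \<in> Sgr k" for x k
  proof -
    define G where "G = {g. U g \<noteq> 0}"
    have "module_hom (*s) (*s) (star x)"
      using star.bilinear_star by (simp add: bilinear_over_def)
    then have "star x (sum U G) = (\<Sum>g\<in>G. star x (U g))"
      by (rule module_hom.sum)
    moreover have "sum U G = u" by (simp add: U_def G_def Sgr.sum_proj)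
    ultimately have "star x u = (\<Sum>g\<in>G. star x (U g))" by simp
    then have "Sgr.proj (star x u) k = (\<Sum>g\<in>G. Sgr.proj (star x (U g)) k)"
      by (simp add: Sgr.proj_sum)
    also have "\<dots> = 0"
    proof (rule sum.neutral, rule ballI)
      fix g assume "g \<in> G"
      then have "g \<noteq> 0" using S_0[of "U 0"] by (auto simp: G_def U_def)
      moreover have "star x (U g) \<in> Sgr (k + g)"
        using algebra_grading_Sgr x by (simp add: algebra_grading_def U_def)
      ultimately show "Sgr.proj (star x (U g)) k = 0"
        using Sgr.proj_homogeneous by simp
    qed
    finally have "polar nrm x u *s U k - x = 0"
      using x unfolding u(2) Sgr.proj_diff Sgr.proj_scale U_def[symmetric]
      by (simp add: Sgr.proj_homogeneous)
    then show ?thesis by simp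
  qed
  obtain k where "U k \<noteq> 0"
  proof (rule ccontr)
    assume "\<not> thesis"
    then have "U k = 0" for k using that by blast
    then have "u = 0" using Sgr.sum_proj[of u] by (simp add: U_def)
    then show False using n_u by (simp add: nrm_def)
  qed
  define x where "x = U k"
  have x: "x \<in> Sgr k" "x \<noteq> 0" using \<open>U k \<noteq> 0\<close> by (simp_all add: x_def U_def)
  let ?t = "polar nrm x u"
  have t: "?t \<noteq> 0" using homogeneous[OF x(1)] x(2) by auto
  have "theta x \<in> V k" "theta x \<noteq> 0"
    using x theta_eq_iff[of x 0] by (simp_all add: Sgr_def)
  then have "nrm x = 0" using isotropic(1)[OF V_0] by (simp add: nrm_def)
  from star_star_para_unit[OF u this]
  have xx: "star x x = ?t *s (?t *s u - x)" .
  \<comment> \<open>As x*x is homogeneous of degree 2k, the formula \<open>xx\<close> confines the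
    support of u to the degrees k and 2k.\<close>
  have proj_u: "U j = 0" if j: "j \<noteq> k" "j \<noteq> k + k" for j
  proof -
    have "star x x \<in> Sgr (k + k)"
      using algebra_grading_Sgr x by (simp add: algebra_grading_def)
    then have "Sgr.proj (star x x) j = 0" "Sgr.proj x j = 0"
      using j x by (simp_all add: Sgr.proj_homogeneous)
    then have "?t *s (?t *s U j - 0) = 0"
      unfolding xx Sgr.proj_scale Sgr.proj_diff U_def by simp
    then show ?thesis using t by simp
  qed
  have span: "y \<in> vec.span {U k, U (k + k)}" for y
  proof (induction y rule: Sgr.homogeneous_induct)
    case (1 j y)
    show ?case
    proof (cases "j = k \<or> j = k + k")
      case True
      then show ?thesis
        using homogeneous[OF 1] by (metis insertI1 insertI2 vec.span_base vec.span_scale)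
    next
      case False
      then have "y = 0" using homogeneous[OF 1] proj_u by simp
      then show ?thesis by (simp add: vec.span_zero)
    qed
  qed (rule vec.span_add)
  have "vec.dim (UNIV :: ('f ^ 8) set) \<le> card {U k, U (k + k)}"
    using span by (intro vec.dim_le_card) auto
  also have "\<dots> \<le> 2" by (simp add: card_insert_if)
  finally show False by (simp add: vec_dim_card del: vec.dim_UNIV)
qed

lemma okubo_star: assumes V_0: "V 0 = {0}" shows "okubo_algebra vector_scalar_mult star nrm"
  unfolding okubo_algebra_def
proof (intro conjI notI)
  show "symmetric_composition_algebra (*s) star nrm" by (rule star.symmetric_composition_algebra_axioms)
  show "vec.dim (UNIV :: ('f ^ 8) set) = 8" by (simp add: vec_dim_card del: vec.dim_UNIV)
  assume "\<exists>star' n' phi. para_cayley_algebra (*s) star' n' \<and>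
    symmetric_composition_iso (*s) star nrm (*s) star' n' (phi :: 'f ^ 8 \<Rightarrow> 'f ^ 8)"
  then obtain star' n' and phi :: "'f ^ 8 \<Rightarrow> 'f ^ 8" where pc: "para_cayley_algebra (*s) star' n'"
    and iso: "symmetric_composition_iso (*s) star nrm (*s) star' n' phi"
    by blast
  obtain u' where u': "n' u' = 1" "\<And>x. star' u' x = polar n' x u' *s u' - x"
    "\<And>x. star' x u' = polar n' x u' *s u' - x"
    using para_cayley_para_unit[OF pc] by blast
  have bij: "bij phi" and hom: "module_hom (*s) (*s) phi"
    and phi_star: "\<And>x y. phi (star x y) = star' (phi x) (phi y)" and phi_n: "\<And>x. n' (phi x) = nrm x"
    using iso by (auto simp: symmetric_composition_iso_def)
  interpret phi: module_hom "(*s)" "(*s)" phi by (rule hom)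
  \<comment> \<open>A para-unit of the para-Cayley algebra pulls back along the isomorphism,
    contradicting \<open>no_para_unit\<close>.\<close>
  define u where "u = inv phi u'"
  have phi_u: "phi u = u'" using bij by (simp add: u_def bij_is_surj surj_f_inv_f)
  have pol: "polar n' (phi x) (phi y) = polar nrm x y" for x y
    by (simp add: polar_def phi_n flip: phi.add)
  have inj: "phi x = phi y \<longleftrightarrow> x = y" for x y
    using bij by (simp add: bij_is_inj inj_eq)
  have "phi (star u x) = phi (polar nrm x u *s u - x)" "phi (star x u) = phi (polar nrm x u *s u - x)" for x
    by (simp_all add: phi_star phi_u u' phi.diff phi.scale flip: pol)
  then show False
    using no_para_unit[OF V_0, of u] phi_n[of u] u'(1) by (simp add: inj phi_u)
qed

lemma para_cayley_star:
  assumes "e \<in> S" "Q e = 1"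
    and "\<And>x. x \<in> S \<Longrightarrow> m e x = smul (b x e) e - x" "\<And>x. x \<in> S \<Longrightarrow> m x e = smul (b x e) e - x"
  shows "para_cayley_algebra vector_scalar_mult star nrm"
proof -
  obtain u where u: "theta u = e" using theta_surj assms(1) by blast
  have "star u x = polar nrm x u *s u - x" "star x u = polar nrm x u *s u - x" for x
    using assms(3,4)[OF theta(1), of x] by (simp_all add: u b_theta flip: theta_eq_iff) (simp_all add: b_theta flip: u)
  moreover have "nrm u = 1" using assms(2) by (simp add: nrm_def u)
  ultimately show ?thesis
    by (intro star.para_cayley_if_para_unit) (simp_all add: vec_dim_card del: vec.dim_UNIV)
qed

end

section \<open>Indexed bases and the final case distinction\<close>

lemma has_rank_8_basis:
  assumes "module smul" "has_rank smul 8"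
  obtains bas :: "8 \<Rightarrow> 'v::ab_group_add" where
    "\<And>x. \<exists>l. x = (\<Sum>i\<in>UNIV. smul (l i) (bas i))"
    "\<And>l i. (\<Sum>i\<in>UNIV. smul (l i) (bas i)) = 0 \<Longrightarrow> l i = 0"
proof -
  interpret module smul by fact
  obtain B where B: "finite B" "card B = 8" "independent B" "span B = UNIV"
    using assms(2) unfolding has_rank_def by blast
  have "\<exists>bas. bij_betw bas (UNIV :: 8 set) B"
    by (rule finite_same_card_bij) (simp_all add: B)
  then obtain bas :: "8 \<Rightarrow> 'v" where bas: "bij_betw bas UNIV B" by blast
  have sum: "(\<Sum>v\<in>B. smul (l v) v) = (\<Sum>i\<in>UNIV. smul (l (bas i)) (bas i))" for l
    by (rule sum.reindex_bij_betw[OF bas, symmetric])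
  show ?thesis
  proof (rule that)
    fix x
    have "x \<in> span B" using B by simp
    then show "\<exists>l. x = (\<Sum>i\<in>UNIV. smul (l i) (bas i))"
      unfolding span_finite[OF B(1)] by (auto simp: sum)
  next
    fix l i assume l: "(\<Sum>i\<in>UNIV. smul (l i) (bas i)) = 0"
    define l' where "l' = l \<circ> inv bas"
    have l': "l' (bas j) = l j" for j
      using bas by (simp add: l'_def bij_betw_def)
    have "bas i \<in> B" using bas by (auto simp: bij_betw_def)
    moreover have "(\<Sum>v\<in>B. smul (l' v) v) = 0"
      using l by (simp add: sum l')
    ultimately show "l i = 0"
      using independentD[OF B(3,1) subset_refl] l' by metis
  qed
qed

theorem theorem16:
  fixes smul :: "('f::alg_closed_field) ^ 3 \<Rightarrow> 'v::ab_group_add \<Rightarrow> 'v"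
    and m :: "'v \<Rightarrow> 'v \<Rightarrow> 'v"
    and Q :: "'v \<Rightarrow> 'f ^ 3"
    and V :: "'g::ab_group_add \<Rightarrow> 'v set"
    and L :: "'g \<Rightarrow> ('f ^ 3) set"
  assumes "CHAR('f) \<noteq> 2" and "CHAR('f) \<noteq> 3"
    and "cyclic_composition_algebra smul m Q"
    and "has_rank smul 8"
    and "cyclic_composition_grading smul m Q V L"
    and "type_III L"
  shows
    "(V 0 = {0} \<longrightarrow>
       (\<exists>(star :: 'f ^ 8 \<Rightarrow> 'f ^ 8 \<Rightarrow> 'f ^ 8) (n :: 'f ^ 8 \<Rightarrow> 'f) (S :: 'g \<Rightarrow> ('f ^ 8) set).
          okubo_algebra vector_scalar_mult star n \<and>
          algebra_grading vector_scalar_mult star S \<and> S 0 = {0} \<and>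
          graded_isomorphic smul m Q V L
            (tensor_scale vector_scalar_mult) (tensor_mult star) (tensor_Q n)
            (tensor_grading vector_scalar_mult S L) L)) \<and>
     (V 0 \<noteq> {0} \<longrightarrow>
       (\<exists>(star :: 'f ^ 8 \<Rightarrow> 'f ^ 8 \<Rightarrow> 'f ^ 8) (n :: 'f ^ 8 \<Rightarrow> 'f) (S :: 'g \<Rightarrow> ('f ^ 8) set).
          para_cayley_algebra vector_scalar_mult star n \<and>
          algebra_grading vector_scalar_mult star S \<and>
          graded_isomorphic smul m Q V L
            (tensor_scale vector_scalar_mult) (tensor_mult star) (tensor_Q n)
            (tensor_grading vector_scalar_mult S L) L))"
proof -
  interpret cyclic_composition_algebra smul m Q by fact
  have char: "(of_nat p :: 'f) \<noteq> 0" if "prime p" "CHAR('f) \<noteq> p" for p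
    using that by (auto simp: of_nat_eq_0_iff_char_dvd prime_nat_iff)
  have two: "(2 :: 'f) \<noteq> 0" and three: "(3 :: 'f) \<noteq> 0"
    using char[of 2] char[of 3] assms(1,2) by auto
  obtain w h where wh: "w ^ 3 = 1" "w \<noteq> 1" "h \<noteq> 0" "h + h + h = 0"
    and L: "L 0 = range (\<lambda>a. a *s 1)" "L h = range (\<lambda>a. a *s vector [1, w, w\<^sup>2])"
      "L (h + h) = range (\<lambda>a. a *s (vector [1, w, w\<^sup>2])\<^sup>2)"
    using assms(6) by (auto simp: type_III_def Let_def)
  define xi where "xi = (vector [1, w, w\<^sup>2] :: 'f ^ 3)"
  have scale: "a *s l = vec a * l" for a and l :: "'f ^ 3"
    by (simp add: vec_eq_iff)
  interpret type_III_algebra smul m Q V L w h xi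
    by unfold_locales
      (use two three wh L assms(5) in \<open>simp_all add: xi_def scale power2_eq_square\<close>)
  obtain bas :: "8 \<Rightarrow> 'v" where bas:
    "\<And>x. \<exists>l. x = (\<Sum>i\<in>UNIV. smul (l i) (bas i))"
    "\<And>l i. (\<Sum>i\<in>UNIV. smul (l i) (bas i)) = 0 \<Longrightarrow> l i = 0"
    using has_rank_8_basis[OF module_axioms assms(4)] by blast
  show ?thesis
  proof (intro conjI impI)
    assume V_0: "V 0 = {0}"
    from exists_complement_form[OF V_0] obtain S where S: "F.subspace S"
      "\<And>x y. x \<in> S \<Longrightarrow> y \<in> S \<Longrightarrow> m x y \<in> S" "\<And>x. x \<in> S \<Longrightarrow> \<exists>a. Q x = vec a"
      "\<And>x g. x \<in> V g \<Longrightarrow> \<exists>s0 s1 s2. s0 \<in> S \<inter> V g \<and> s1 \<in> S \<inter> V (g - h) \<and>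
          s2 \<in> S \<inter> V (g - (h + h)) \<and> x = s0 + smul xi s1 + smul (xi * xi) s2"
      by blast
    interpret descent smul m Q V L w h xi S bas
      by unfold_locales (fact S bas)+
    have "Sgr 0 = {0}"
      using V_0 theta_eq_iff[of _ 0] by (auto simp: Sgr_def)
    then show "\<exists>star n (S :: 'g \<Rightarrow> ('f ^ 8) set). okubo_algebra (*s) star n \<and>
        algebra_grading (*s) star S \<and> S 0 = {0} \<and>
        graded_isomorphic smul m Q V L (tensor_scale (*s)) (tensor_mult star) (tensor_Q n)
          (tensor_grading (*s) S L) L"
      using okubo_star[OF V_0] algebra_grading_Sgr graded_isomorphic_tensor by blast
  next
    assume V_0: "V 0 \<noteq> {0}"
    have roots: "\<exists>r. r\<^sup>2 = t" for t :: 'f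
    proof -
      obtain r where "poly [:- t, 0, 1:] r = 0"
        using alg_closed_imp_poly_has_root[of "[:- t, 0, 1:]"] by auto
      then show ?thesis by (auto simp: power2_eq_square)
    qed
    have "\<exists>a c. c \<noteq> 0 \<and> a = 2 * a * c + c\<^sup>2 * t \<and> c = a\<^sup>2 - c\<^sup>2" for t :: 'f
      using idempotent_equations[OF two three, of t] by metis
    from exists_idempotent[OF V_0 this roots]
    obtain e where e: "e \<in> V 0" "m e e = e" "Q e = 1" by blast
    interpret type_III_idempotent smul m Q V L w h xi e
      by unfold_locales (fact e)+
    interpret descent smul m Q V L w h xi "{x. aut x = x}" bas
    proof unfold_locales
      \<comment> \<open>Q(aut x) = rho(Q x), so Q takes \<open>rho\<close>-fixed, hence scalar,
        values on fixed points.\<close>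
      show "\<exists>a. Q x = vec a" if "x \<in> {x. aut x = x}" for x
        using that Q_aut[of x] rho_fixed_imp_vec[of "Q x"] by auto
    qed (use fixed_split in \<open>simp_all add: subspace_fixed bas\<close>)
    have "para_cayley_algebra (*s) star nrm"
      by (rule para_cayley_star[of e]) (simp_all add: aut_fixed_para_unit cnj_def)
    then show "\<exists>star n (S :: 'g \<Rightarrow> ('f ^ 8) set). para_cayley_algebra (*s) star n \<and>
        algebra_grading (*s) star S \<and>
        graded_isomorphic smul m Q V L (tensor_scale (*s)) (tensor_mult star) (tensor_Q n)
          (tensor_grading (*s) S L) L"
      using algebra_grading_Sgr graded_isomorphic_tensor by blast
  qed
qed

end
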